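(* There exist natural numbers $l,m,n$ such that the following set is undecidable: the set of prenex sentences in the first-order language with binary relation symbol $\sim$ and equality whose quantifier prefix has the form $\exists^j\forall^l\exists^m\forall^n$ for some $j\ge0$ (i.e. $j$ existential quantifiers, then $l$ universal, then $m$ existential, then $n$ universal) and which are true on some finite graph.
   Context: A graph is a structure for this language in which $\sim$ is interpreted by an irreflexive symmetric relation. *)

theory Defs
  imports Main "HOL-Library.Nat_Bijection"
begin

datatype fm =
    Eq nat nat
  | Rel nat nat
  | Neg fm
  | Conj fm fm
  | Disj fm fm
  | Imp fm fm
  | Ex nat fm
  | All nat fm

fun qfree :: "fm \<Rightarrow> bool" where
  "qfree (Eq i j) = True"
| "qfree (Rel i j) = True"
| "qfree (Neg p) = qfree p"
| "qfree (Conj p q) = (qfree p \<and> qfree q)"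
| "qfree (Disj p q) = (qfree p \<and> qfree q)"
| "qfree (Imp p q) = (qfree p \<and> qfree q)"
| "qfree (Ex x p) = False"
| "qfree (All x p) = False"

fun freevars :: "fm \<Rightarrow> nat set" where
  "freevars (Eq i j) = {i, j}"
| "freevars (Rel i j) = {i, j}"
| "freevars (Neg p) = freevars p"
| "freevars (Conj p q) = freevars p \<union> freevars q"
| "freevars (Disj p q) = freevars p \<union> freevars q"
| "freevars (Imp p q) = freevars p \<union> freevars q"
| "freevars (Ex x p) = freevars p - {x}"
| "freevars (All x p) = freevars p - {x}"

definition sentence :: "fm \<Rightarrow> bool" where
  "sentence p \<longleftrightarrow> freevars p = {}"

fun qprefix :: "fm \<Rightarrow> bool list" where
  "qprefix (Ex x p) = True # qprefix p"
| "qprefix (All x p) = False # qprefix p"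
| "qprefix p = []"

fun matrix :: "fm \<Rightarrow> fm" where
  "matrix (Ex x p) = matrix p"
| "matrix (All x p) = matrix p"
| "matrix p = p"

definition prenex :: "fm \<Rightarrow> bool" where
  "prenex p \<longleftrightarrow> qfree (matrix p)"

fun sat :: "nat set \<Rightarrow> (nat \<Rightarrow> nat \<Rightarrow> bool) \<Rightarrow> (nat \<Rightarrow> nat) \<Rightarrow> fm \<Rightarrow> bool" where
  "sat V E a (Eq i j) = (a i = a j)"
| "sat V E a (Rel i j) = E (a i) (a j)"
| "sat V E a (Neg p) = (\<not> sat V E a p)"
| "sat V E a (Conj p q) = (sat V E a p \<and> sat V E a q)"
| "sat V E a (Disj p q) = (sat V E a p \<or> sat V E a q)"
| "sat V E a (Imp p q) = (sat V E a p \<longrightarrow> sat V E a q)"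
| "sat V E a (Ex x p) = (\<exists>v\<in>V. sat V E (a(x := v)) p)"
| "sat V E a (All x p) = (\<forall>v\<in>V. sat V E (a(x := v)) p)"

definition true_in :: "nat set \<Rightarrow> (nat \<Rightarrow> nat \<Rightarrow> bool) \<Rightarrow> fm \<Rightarrow> bool" where
  "true_in V E p \<longleftrightarrow> (\<forall>a. (\<forall>x. a x \<in> V) \<longrightarrow> sat V E a p)"

definition finite_graph :: "nat set \<Rightarrow> (nat \<Rightarrow> nat \<Rightarrow> bool) \<Rightarrow> bool" where
  "finite_graph V E \<longleftrightarrow> finite V \<and> V \<noteq> {} \<and>
     (\<forall>x y. E x y \<longrightarrow> x \<in> V \<and> y \<in> V) \<and>
     (\<forall>x. \<not> E x x) \<and> (\<forall>x y. E x y \<longrightarrow> E y x)"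

definition fin_graph_satisfiable :: "fm \<Rightarrow> bool" where
  "fin_graph_satisfiable p \<longleftrightarrow> (\<exists>V E. finite_graph V E \<and> true_in V E p)"

definition SAT_class :: "nat \<Rightarrow> nat \<Rightarrow> nat \<Rightarrow> fm set" where
  "SAT_class l m n = {p. sentence p \<and> prenex p \<and>
     (\<exists>j. qprefix p = replicate j True @ replicate l False @ replicate m True @ replicate n False) \<and>
     fin_graph_satisfiable p}"

fun code :: "fm \<Rightarrow> nat" where
  "code (Eq i j) = prod_encode (0, prod_encode (i, j))"
| "code (Rel i j) = prod_encode (1, prod_encode (i, j))"
| "code (Neg p) = prod_encode (2, code p)"
| "code (Conj p q) = prod_encode (3, prod_encode (code p, code q))"
| "code (Disj p q) = prod_encode (4, prod_encode (code p, code q))"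
| "code (Imp p q) = prod_encode (5, prod_encode (code p, code q))"
| "code (Ex x p) = prod_encode (6, prod_encode (x, code p))"
| "code (All x p) = prod_encode (7, prod_encode (x, code p))"

definition primrec_op :: "(nat list \<Rightarrow> nat) \<Rightarrow> (nat list \<Rightarrow> nat) \<Rightarrow> nat list \<Rightarrow> nat" where
  "primrec_op f g xs = (case xs of [] \<Rightarrow> 0
     | (y # ys) \<Rightarrow> rec_nat (f ys) (\<lambda>z r. g (z # r # ys)) y)"

inductive recursive :: "nat \<Rightarrow> (nat list \<Rightarrow> nat) \<Rightarrow> bool" where
  zero: "recursive k (\<lambda>_. 0)"
| succ: "recursive 1 (\<lambda>xs. Suc (hd xs))"
| proj: "i < k \<Longrightarrow> recursive k (\<lambda>xs. xs ! i)"
| comp: "recursive (length hs) g \<Longrightarrow> (\<forall>h\<in>set hs. recursive k h) \<Longrightarrow>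
         recursive k (\<lambda>xs. g (map (\<lambda>h. h xs) hs))"
| prim: "recursive k f \<Longrightarrow> recursive (Suc (Suc k)) g \<Longrightarrow> recursive (Suc k) (primrec_op f g)"
| mini: "recursive (Suc k) f \<Longrightarrow> (\<forall>xs. length xs = k \<longrightarrow> (\<exists>y. f (y # xs) = 0)) \<Longrightarrow>
         recursive k (\<lambda>xs. LEAST y. f (y # xs) = 0)"

definition decidable :: "nat set \<Rightarrow> bool" where
  "decidable A \<longleftrightarrow> (\<exists>f. recursive 1 f \<and> (\<forall>x. f [x] = 0 \<longleftrightarrow> x \<in> A))"

end

(* A computation of a program is witnessed by a finite derivation tree, and the correctness of such a
   tree is a local condition on its nodes.  Finitely many trees ordered by size form a finite structure
   with the relations "left subtree", "right subtree", "smaller" and "valid derivation"; conversely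
   any finite structure satisfying a few axioms unfolds, by recursion along the strict order, into
   genuine trees all of whose marked nodes are valid derivations.  All axioms have the form
   "for all x, y, z there are w_1, ..., w_k such that ...", without negation of the relations
   below the existential quantifiers.

   To code the structure in a graph, each element becomes four vertices, the first joined to the
   other three and the i-th joined to the i-th of four existentially quantified constants.  For
   1 < i < j the edges between i-th and j-th copies can form any directed relation, and the axioms
   keep the prefix "exists* forall^12 exists^m".  The input number e enters only through a chain
   of further existential constants representing the numerals up to e + 11.

   Programs are decoded from numbers by the derivation rules themselves, so a sentence phi e says
   that the program with number e returns 0 on input e.  Deciding these sentences contradicts
   diagonalization, since e is mapped recursively to the code of phi e. *)

theory Submission
  imports Defs "HOL-Library.Countable"
begin

section \<open>Programs as trees\<close>

datatype tree = Tip | Br tree tree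

fun num :: "nat \<Rightarrow> tree" where
  "num 0 = Tip"
| "num (Suc n) = Br Tip (num n)"

lemma num_eq_Tip [simp]: "num n = Tip \<longleftrightarrow> n = 0" "Tip = num n \<longleftrightarrow> n = 0"
  by (cases n; simp)+

lemma num_eq_Br [simp]:
  "num n = Br a b \<longleftrightarrow> n > 0 \<and> a = Tip \<and> b = num (n - 1)"
  "Br a b = num n \<longleftrightarrow> n > 0 \<and> a = Tip \<and> b = num (n - 1)"
  by (cases n; auto)+

lemma size_num [simp]: "size (num n) = n"
  by (induction n) auto

lemma num_inject [simp]: "num m = num n \<longleftrightarrow> m = n"
  by (metis size_num)

text \<open>Atomic instructions are numerals and compound ones have a left subtree other than Tip, so that
  no tree can be read in two ways.  Tip itself is the constant zero program.\<close>

abbreviation "tId \<equiv> num 2"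
abbreviation "tHd \<equiv> num 3"
abbreviation "tTl \<equiv> num 4"
abbreviation "tUnpair \<equiv> num 5"
abbreviation "tDecode \<equiv> num 6"
abbreviation "tDiag \<equiv> num 7"
abbreviation "tPair f g \<equiv> Br (num 8) (Br f g)"
abbreviation "tComp g f \<equiv> Br (num 9) (Br g f)"
abbreviation "tRec f g \<equiv> Br (num 10) (Br f g)"
abbreviation "tMin f \<equiv> Br (num 11) f"

text \<open>The input is a list in tree form. \<open>tRec\<close> recurses on its head, and
  \<open>tMin\<close> searches upward from its head. \<open>tUnpair\<close> and
  \<open>tDecode\<close> turn a numeral into a program, so \<open>tDiag\<close> can run program
  number \<open>e\<close> on the one-element list of \<open>e\<close>.\<close>

inductive ev :: "tree \<Rightarrow> tree \<Rightarrow> tree \<Rightarrow> bool" where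
  ev_zero: "ev Tip x Tip"
| ev_id: "ev tId x x"
| ev_hd: "ev tHd (Br x y) x"
| ev_tl: "ev tTl (Br x y) y"
| ev_pair: "ev f x u \<Longrightarrow> ev g x v \<Longrightarrow> ev (tPair f g) x (Br u v)"
| ev_comp: "ev f x z \<Longrightarrow> ev g z y \<Longrightarrow> ev (tComp g f) x y"
| ev_rec_0: "ev f x y \<Longrightarrow> ev (tRec f g) (Br Tip x) y"
| ev_rec_Suc: "ev (tRec f g) (Br n x) r \<Longrightarrow> ev g (Br n (Br r x)) y \<Longrightarrow>
    ev (tRec f g) (Br (Br Tip n) x) y"
| ev_min_found: "ev f (Br n x) Tip \<Longrightarrow> ev (tMin f) (Br n x) n"
| ev_min_next: "ev f (Br n x) (Br a b) \<Longrightarrow> ev (tMin f) (Br (Br Tip n) x) y \<Longrightarrow>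
    ev (tMin f) (Br n x) y"
| ev_unpair_0: "ev tUnpair Tip (Br Tip Tip)"
| ev_unpair_down: "ev tUnpair e (Br a (Br Tip b)) \<Longrightarrow> ev tUnpair (Br Tip e) (Br (Br Tip a) b)"
| ev_unpair_turn: "ev tUnpair e (Br a Tip) \<Longrightarrow> ev tUnpair (Br Tip e) (Br Tip (Br Tip a))"
| ev_decode_0: "ev tDecode Tip Tip"
| ev_decode_Suc: "ev tUnpair e (Br a b) \<Longrightarrow> ev tDecode a x \<Longrightarrow> ev tDecode b y \<Longrightarrow>
    ev tDecode (Br Tip e) (Br x y)"
| ev_diag: "ev tDecode e t \<Longrightarrow> ev t (Br e Tip) y \<Longrightarrow> ev tDiag e y"

text \<open>Rule inversion: distinct head numerals exclude all but the matching rules.\<close>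

lemma ev_iff:
  "ev Tip x y \<longleftrightarrow> y = Tip"
  "ev tId x y \<longleftrightarrow> y = x"
  "ev tHd x y \<longleftrightarrow> (\<exists>z. x = Br y z)"
  "ev tTl x y \<longleftrightarrow> (\<exists>z. x = Br z y)"
  "ev (tPair f g) x y \<longleftrightarrow> (\<exists>u v. y = Br u v \<and> ev f x u \<and> ev g x v)"
  "ev (tComp g f) x y \<longleftrightarrow> (\<exists>z. ev f x z \<and> ev g z y)"
  "ev (tRec f g) (Br Tip x) y \<longleftrightarrow> ev f x y"
  "ev (tRec f g) (Br (Br Tip n) x) y \<longleftrightarrow>
     (\<exists>r. ev (tRec f g) (Br n x) r \<and> ev g (Br n (Br r x)) y)"
  by (subst ev.simps; force)+

text \<open>Stated apart because its right-hand side contains an instance of its left-hand side, so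
  unrestricted rewriting would loop.\<close>

lemma ev_min_iff:
  "ev (tMin f) (Br n x) y \<longleftrightarrow> ev f (Br n x) Tip \<and> y = n \<or>
     (\<exists>a b. ev f (Br n x) (Br a b) \<and> ev (tMin f) (Br (Br Tip n) x) y)"
  by (subst ev.simps; force)

lemma ev_decode_iff:
  "ev tUnpair Tip y \<longleftrightarrow> y = Br Tip Tip"
  "ev tUnpair (Br Tip e) y \<longleftrightarrow>
     (\<exists>a b. ev tUnpair e (Br a (Br Tip b)) \<and> y = Br (Br Tip a) b) \<or>
     (\<exists>a. ev tUnpair e (Br a Tip) \<and> y = Br Tip (Br Tip a))"
  "ev tDecode Tip y \<longleftrightarrow> y = Tip"
  "ev tDecode (Br Tip e) y \<longleftrightarrow>
     (\<exists>a b u v. ev tUnpair e (Br a b) \<and> ev tDecode a u \<and> ev tDecode b v \<and> y = Br u v)"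
  "ev tDiag e y \<longleftrightarrow> (\<exists>t. ev tDecode e t \<and> ev t (Br e Tip) y)"
  by (subst ev.simps; force)+

text \<open>The rules for \<open>tUnpair\<close> walk along the diagonals of the Cantor pairing:
  after \<open>(a, Suc b)\<close> comes \<open>(Suc a, b)\<close>, and after \<open>(a, 0)\<close>
  comes \<open>(0, Suc a)\<close>.\<close>

lemma ev_unpair: "ev tUnpair (num e) y \<longleftrightarrow> (\<exists>a b. prod_encode (a, b) = e \<and> y = Br (num a) (num b))"
proof (induction e arbitrary: y)
  case 0
  have "prod_encode (a, b) = 0 \<longleftrightarrow> a = 0 \<and> b = 0" for a b
    by (simp add: prod_encode_def triangle_def) (cases "a + b"; auto)
  then show ?case by (simp add: ev_decode_iff)
next
  case (Suc e)
  have step: "prod_encode (a, b) = Suc e \<longleftrightarrow>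
     (\<exists>a'. a = Suc a' \<and> prod_encode (a', Suc b) = e) \<or>
     (\<exists>b'. a = 0 \<and> b = Suc b' \<and> prod_encode (b', 0) = e)" for a b
    by (cases a; cases b) (auto simp: prod_encode_def)
  have "ev tUnpair (num (Suc e)) y \<longleftrightarrow>
     (\<exists>a b. prod_encode (a, Suc b) = e \<and> y = Br (num (Suc a)) (num b)) \<or>
     (\<exists>a. prod_encode (a, 0) = e \<and> y = Br (num 0) (num (Suc a)))"
    unfolding num.simps(2) ev_decode_iff Suc by (auto simp: gr0_conv_Suc)
  also have "\<dots> \<longleftrightarrow> (\<exists>a b. prod_encode (a, b) = Suc e \<and> y = Br (num a) (num b))"
    unfolding step by blast
  finally show ?case .
qed

text \<open>\<open>Tip\<close> has number 0, and a branch has the successor of the pair of the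
  numbers of its subtrees. The equivalence over all \<open>y\<close> includes uniqueness of the
  decoded program.\<close>

lemma decode_surj: "\<exists>e. \<forall>y. ev tDecode (num e) y \<longleftrightarrow> y = t"
proof (induction t)
  case Tip
  show ?case by (rule exI[of _ 0]) (simp add: ev_decode_iff)
next
  case (Br t1 t2)
  then obtain e1 e2 where e: "\<forall>y. ev tDecode (num e1) y \<longleftrightarrow> y = t1"
    "\<forall>y. ev tDecode (num e2) y \<longleftrightarrow> y = t2" by blast
  show ?case
    by (rule exI[of _ "Suc (prod_encode (e1, e2))"])
       (auto simp: ev_decode_iff ev_unpair e)
qed

section \<open>Programs for all recursive functions\<close>

definition lst :: "nat list \<Rightarrow> tree" where
  "lst xs = foldr (\<lambda>x. Br (num x)) xs Tip"

lemma lst_simps [simp]: "lst [] = Tip" "lst (x # xs) = Br (num x) (lst xs)"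
  by (simp_all add: lst_def)

text \<open>The equivalence demands both termination and uniqueness of the value.\<close>

definition computes :: "nat \<Rightarrow> tree \<Rightarrow> (nat list \<Rightarrow> nat) \<Rightarrow> bool" where
  "computes k t f \<longleftrightarrow> (\<forall>xs y. length xs = k \<longrightarrow> (ev t (lst xs) y \<longleftrightarrow> y = num (f xs)))"

lemma computes_proj: "\<exists>t. \<forall>xs y. i < length xs \<longrightarrow> (ev t (lst xs) y \<longleftrightarrow> y = num (xs ! i))"
proof (induction i)
  case 0
  show ?case
    by (rule exI[of _ tHd]) (auto simp: ev_iff neq_Nil_conv)
next
  case (Suc i)
  then obtain t where t: "\<forall>xs y. i < length xs \<longrightarrow> (ev t (lst xs) y \<longleftrightarrow> y = num (xs ! i))" ..
  have "ev (tComp t tTl) (lst xs) y \<longleftrightarrow> y = num (xs ! Suc i)" if "Suc i < length xs" for xs y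
    using that t by (cases xs) (auto simp: ev_iff)
  then show ?case by blast
qed

lemma computes_tuple:
  assumes "\<forall>h\<in>set hs. \<exists>t. computes k t h"
  shows "\<exists>t. \<forall>xs y. length xs = k \<longrightarrow> (ev t (lst xs) y \<longleftrightarrow> y = lst (map (\<lambda>h. h xs) hs))"
  using assms
proof (induction hs)
  case Nil
  show ?case by (rule exI[of _ Tip]) (simp add: ev_iff)
next
  case (Cons h hs)
  then obtain s t where "computes k s h"
    "\<forall>xs y. length xs = k \<longrightarrow> (ev t (lst xs) y \<longleftrightarrow> y = lst (map (\<lambda>h. h xs) hs))" by auto
  then show ?case
    by (intro exI[of _ "tPair s t"]) (auto simp: ev_iff computes_def)
qed

text \<open>Induction over the schemes generating recursive functions, each of which is matched by
  an instruction or a short combination of instructions.\<close>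

theorem recursive_computes: "recursive k f \<Longrightarrow> \<exists>t. computes k t f"
proof (induction rule: recursive.induct)
  case (zero k)
  show ?case by (rule exI[of _ Tip]) (simp add: computes_def ev_iff)
next
  case succ
  have "ev (tPair Tip tHd) (lst xs) y \<longleftrightarrow> y = num (Suc (hd xs))" if "length xs = 1" for xs y
    using that by (cases xs) (auto simp: ev_iff)
  then show ?case unfolding computes_def by blast
next
  case (proj i k)
  then show ?case using computes_proj[of i] unfolding computes_def by auto
next
  case (comp hs g k)
  then obtain s t where "computes (length hs) s g"
    "\<forall>xs y. length xs = k \<longrightarrow> (ev t (lst xs) y \<longleftrightarrow> y = lst (map (\<lambda>h. h xs) hs))"
    using computes_tuple[of hs k] by blast
  then show ?case
    by (intro exI[of _ "tComp s t"]) (auto simp: computes_def ev_iff)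
next
  case (prim k f g)
  then obtain s t where st: "computes k s f" "computes (Suc (Suc k)) t g" by blast
  have "ev (tRec s t) (lst (n # xs)) y \<longleftrightarrow> y = num (primrec_op f g (n # xs))"
    if "length xs = k" for n xs y
  proof (induction n arbitrary: y)
    case 0
    show ?case using that st by (simp add: ev_iff computes_def primrec_op_def)
  next
    case (Suc n)
    have "ev t (Br (num n) (Br (num r) (lst xs))) z \<longleftrightarrow> z = num (g (n # r # xs))" for r z
      using st(2) that unfolding computes_def by (metis length_Cons lst_simps(2))
    with Suc show ?case by (simp add: ev_iff primrec_op_def)
  qed
  then have "computes (Suc k) (tRec s t) (primrec_op f g)"
    unfolding computes_def by (metis length_Suc_conv)
  then show ?case ..
next
  case (mini k f)
  then obtain t where t: "computes (Suc k) t f" by blast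
  \<comment> \<open>Downward induction from the least zero \<open>m\<close> to the starting point
    \<open>n\<close>: at \<open>m\<close> the test succeeds, and below \<open>m\<close> it returns a
    nonzero numeral, which is a \<open>Br\<close>, so the search moves on.\<close>
  have search: "ev (tMin t) (lst (n # xs)) y \<longleftrightarrow> y = num m"
    if "length xs = k" "f (m # xs) = 0" "\<And>i. i < m \<Longrightarrow> f (i # xs) \<noteq> 0" "n \<le> m" for n m xs y
    using \<open>n \<le> m\<close>
  proof (induction rule: inc_induct)
    case base
    have "ev t (Br (num m) (lst xs)) z \<longleftrightarrow> z = Tip" for z
      using t that(1,2) unfolding computes_def by (metis length_Cons lst_simps(2) num.simps(1))
    then show ?case by (subst lst_simps, subst ev_min_iff) simp
  next
    case (step n)
    have "ev t (Br (num n) (lst xs)) z \<longleftrightarrow> z = num (f (n # xs))" for z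
      using t that(1) unfolding computes_def by (metis length_Cons lst_simps(2))
    then show ?case
      using step that(3)[of n] by (simp add: ev_min_iff[of _ "num n"])
  qed
  \<comment> \<open>The search starts at zero because \<open>tPair Tip tId\<close> puts
    \<open>Tip\<close> in front of the arguments.\<close>
  have "ev (tComp (tMin t) (tPair Tip tId)) (lst xs) y \<longleftrightarrow> y = num (LEAST y. f (y # xs) = 0)"
    if "length xs = k" for xs y
  proof -
    have "\<exists>y. f (y # xs) = 0" using mini that by blast
    then have "ev (tMin t) (lst (0 # xs)) y \<longleftrightarrow> y = num (LEAST y. f (y # xs) = 0)"
      by (intro search that) (auto intro: LeastI_ex dest: not_less_Least)
    then show ?thesis by (simp add: ev_iff)
  qed
  then show ?case unfolding computes_def by blast
qed

section \<open>Derivations as trees\<close>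

text \<open>A rule is a single pattern for the whole derivation tree: conclusion on the left, list of
  premises on the right.  PDer marks a subtree that must itself be a valid derivation.\<close>

datatype pat = PVar nat | PNum nat | PBr pat pat | PDer pat

fun inst :: "(nat \<Rightarrow> tree) \<Rightarrow> pat \<Rightarrow> tree" where
  "inst \<sigma> (PVar i) = \<sigma> i"
| "inst \<sigma> (PNum n) = num n"
| "inst \<sigma> (PBr p q) = Br (inst \<sigma> p) (inst \<sigma> q)"
| "inst \<sigma> (PDer p) = inst \<sigma> p"

fun marked :: "pat \<Rightarrow> pat set" where
  "marked (PVar i) = {}"
| "marked (PNum n) = {}"
| "marked (PBr p q) = marked p \<union> marked q"
| "marked (PDer p) = insert p (marked p)"

text \<open>The list of subderivations of each premise stays open as a fresh variable.
  \<open>rule\<close> numbers these variables from 6 because the rules themselves use only 0 to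
  5.\<close>

fun hyps :: "nat \<Rightarrow> pat list \<Rightarrow> pat" where
  "hyps i [] = PNum 0"
| "hyps i (p # ps) = PBr (PDer (PBr p (PVar i))) (hyps (Suc i) ps)"

abbreviation judgement :: "pat \<Rightarrow> pat \<Rightarrow> pat \<Rightarrow> pat" where
  "judgement t x y \<equiv> PBr t (PBr x y)"

abbreviation pSuc :: "pat \<Rightarrow> pat" where
  "pSuc n \<equiv> PBr (PNum 0) n"

definition rule :: "pat \<Rightarrow> pat list \<Rightarrow> pat" where
  "rule c ps = PBr c (hyps 6 ps)"

definition rules :: "pat list" where
  "rules =
    (let a = PVar 0; b = PVar 1; c = PVar 2; d = PVar 3; e = PVar 4; f = PVar 5; z = PNum 0;
         loop = PBr (PNum 10) (PBr a b); mu = PBr (PNum 11) a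
     in
     [rule (judgement z a z) [],
      rule (judgement (PNum 2) a a) [],
      rule (judgement (PNum 3) (PBr a b) a) [],
      rule (judgement (PNum 4) (PBr a b) b) [],
      rule (judgement (PBr (PNum 8) (PBr a b)) c (PBr d e)) [judgement a c d, judgement b c e],
      rule (judgement (PBr (PNum 9) (PBr b a)) c e) [judgement a c d, judgement b d e],
      rule (judgement loop (PBr z c) d) [judgement a c d],
      rule (judgement loop (PBr (pSuc c) d) f)
        [judgement loop (PBr c d) e, judgement b (PBr c (PBr e d)) f],
      rule (judgement mu (PBr b c) b) [judgement a (PBr b c) z],
      rule (judgement mu (PBr b c) f)
        [judgement a (PBr b c) (PBr d e), judgement mu (PBr (pSuc b) c) f],
      rule (judgement (PNum 5) z (PBr z z)) [],
      rule (judgement (PNum 5) (pSuc a) (PBr (pSuc b) c)) [judgement (PNum 5) a (PBr b (pSuc c))],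
      rule (judgement (PNum 5) (pSuc a) (PBr z (pSuc b))) [judgement (PNum 5) a (PBr b z)],
      rule (judgement (PNum 6) z z) [],
      rule (judgement (PNum 6) (pSuc a) (PBr d e))
        [judgement (PNum 5) a (PBr b c), judgement (PNum 6) b d, judgement (PNum 6) c e],
      rule (judgement (PNum 7) a c) [judgement (PNum 6) a b, judgement b (PBr a z) c]])"

inductive valid :: "tree \<Rightarrow> bool" where
  "p \<in> set rules \<Longrightarrow> \<forall>q\<in>marked p. valid (inst \<sigma> q) \<Longrightarrow> valid (inst \<sigma> p)"

text \<open>The sixteen patterns mirror the introduction rules of \<open>ev\<close> in order;
  \<open>p\<close> holds the derivations of the premises.\<close>

lemma valid_ev: "valid d \<Longrightarrow> \<exists>t x y p. d = Br (Br t (Br x y)) p \<and> ev t x y"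
proof (induction rule: valid.induct)
  case (1 p \<sigma>)
  then show ?case
    by (simp add: rules_def Let_def rule_def ball_Un del: num.simps(2))
       (elim disjE; simp; blast intro: ev.intros)
qed

text \<open>In each case the list assigns the rule variables at indices 0 to 5, padded with
  \<open>Tip\<close>, and the premise lists of the subderivations from index 6 on.\<close>

lemma ev_valid: "ev t x y \<Longrightarrow> \<exists>p. valid (Br (Br t (Br x y)) p)"
proof (induction rule: ev.induct)
  case (ev_zero x)
  show ?case
    using valid.intros[of "rules ! 0" "\<lambda>i. x"] by (auto simp: rules_def Let_def rule_def)
next
  case (ev_id x)
  show ?case
    using valid.intros[of "rules ! 1" "\<lambda>i. x"] by (auto simp: rules_def Let_def rule_def)
next
  case (ev_hd x y)
  show ?case
    using valid.intros[of "rules ! 2" "(!) [x, y]"] by (auto simp: rules_def Let_def rule_def)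
next
  case (ev_tl x y)
  show ?case
    using valid.intros[of "rules ! 3" "(!) [x, y]"] by (auto simp: rules_def Let_def rule_def)
next
  case (ev_pair f x u g v)
  then obtain p q where "valid (Br (Br f (Br x u)) p)" "valid (Br (Br g (Br x v)) q)" by blast
  then show ?case
    using valid.intros[of "rules ! 4" "(!) [f, g, x, u, v, Tip, p, q]"]
    by (auto simp: rules_def Let_def rule_def)
next
  case (ev_comp f x z g y)
  then obtain p q where "valid (Br (Br f (Br x z)) p)" "valid (Br (Br g (Br z y)) q)" by blast
  then show ?case
    using valid.intros[of "rules ! 5" "(!) [f, g, x, z, y, Tip, p, q]"]
    by (auto simp: rules_def Let_def rule_def)
next
  case (ev_rec_0 f x y g)
  then obtain p where "valid (Br (Br f (Br x y)) p)" by blast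
  then show ?case
    using valid.intros[of "rules ! 6" "(!) [f, g, x, y, Tip, Tip, p]"]
    by (auto simp: rules_def Let_def rule_def)
next
  case (ev_rec_Suc f g n x r y)
  then obtain p q where "valid (Br (Br (tRec f g) (Br (Br n x) r)) p)"
    "valid (Br (Br g (Br (Br n (Br r x)) y)) q)" by blast
  then show ?case
    using valid.intros[of "rules ! 7" "(!) [f, g, n, x, r, y, p, q]"]
    by (auto simp: rules_def Let_def rule_def)
next
  case (ev_min_found f n x)
  then obtain p where "valid (Br (Br f (Br (Br n x) Tip)) p)" by blast
  then show ?case
    using valid.intros[of "rules ! 8" "(!) [f, n, x, Tip, Tip, Tip, p]"]
    by (auto simp: rules_def Let_def rule_def)
next
  case (ev_min_next f n x a b y)
  then obtain p q where "valid (Br (Br f (Br (Br n x) (Br a b))) p)"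
    "valid (Br (Br (tMin f) (Br (Br (Br Tip n) x) y)) q)" by blast
  then show ?case
    using valid.intros[of "rules ! 9" "(!) [f, n, x, a, b, y, p, q]"]
    by (auto simp: rules_def Let_def rule_def)
next
  case ev_unpair_0
  show ?case
    using valid.intros[of "rules ! 10" "\<lambda>i. Tip"] by (auto simp: rules_def Let_def rule_def)
next
  case (ev_unpair_down e a b)
  then obtain p where "valid (Br (Br tUnpair (Br e (Br a (Br Tip b)))) p)" by blast
  then show ?case
    using valid.intros[of "rules ! 11" "(!) [e, a, b, Tip, Tip, Tip, p]"]
    by (auto simp: rules_def Let_def rule_def)
next
  case (ev_unpair_turn e a)
  then obtain p where "valid (Br (Br tUnpair (Br e (Br a Tip))) p)" by blast
  then show ?case
    using valid.intros[of "rules ! 12" "(!) [e, a, Tip, Tip, Tip, Tip, p]"]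
    by (auto simp: rules_def Let_def rule_def)
next
  case ev_decode_0
  show ?case
    using valid.intros[of "rules ! 13" "\<lambda>i. Tip"] by (auto simp: rules_def Let_def rule_def)
next
  case (ev_decode_Suc e a b x y)
  then obtain p q r where "valid (Br (Br tUnpair (Br e (Br a b))) p)"
    "valid (Br (Br tDecode (Br a x)) q)" "valid (Br (Br tDecode (Br b y)) r)" by blast
  then show ?case
    using valid.intros[of "rules ! 14" "(!) [e, a, b, x, y, Tip, p, q, r]"]
    by (auto simp: rules_def Let_def rule_def)
next
  case (ev_diag e t y)
  then obtain p q where "valid (Br (Br tDecode (Br e t)) p)"
    "valid (Br (Br t (Br (Br e Tip) y)) q)" by blast
  then show ?case
    using valid.intros[of "rules ! 15" "(!) [e, t, y, Tip, Tip, Tip, p, q]"]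
    by (auto simp: rules_def Let_def rule_def)
qed

section \<open>Sizes and heap addresses of rule patterns\<close>

lemma size_marked: "q \<in> marked p \<Longrightarrow> size (inst \<sigma> q) \<le> size (inst \<sigma> p)"
  by (induction p) auto

fun pvars :: "pat \<Rightarrow> nat set" where
  "pvars (PVar i) = {i}"
| "pvars (PNum n) = {}"
| "pvars (PBr p q) = pvars p \<union> pvars q"
| "pvars (PDer p) = pvars p"

lemma size_pvars: "i \<in> pvars p \<Longrightarrow> size (\<sigma> i) \<le> size (inst \<sigma> p)"
  by (induction p) auto

text \<open>The root of a rule is a \<open>PBr\<close>, so marks occur only in proper subtrees. The
  strict decrease allows comparison of sizes to interpret \<open>lt\<close> in the models built from
  trees.\<close>

lemma rules_size_marked:
  assumes "p \<in> set rules" "q \<in> marked p"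
  shows "size (inst \<sigma> q) < size (inst \<sigma> p)"
proof -
  obtain a b where "p = PBr a b"
    using assms(1) by (auto simp: rules_def Let_def rule_def)
  then show ?thesis
    using assms(2) by (auto dest!: size_marked[of q _ \<sigma>])
qed

text \<open>The root of the pattern sits at heap address \<open>i\<close>, and \<open>h\<close>
  bounds addresses as well as variable numbers. The largest instruction numeral is 11.\<close>

fun bounded :: "nat \<Rightarrow> nat \<Rightarrow> pat \<Rightarrow> bool" where
  "bounded h i (PVar v) \<longleftrightarrow> i < h \<and> v < h"
| "bounded h i (PNum n) \<longleftrightarrow> i < h \<and> n \<le> 11"
| "bounded h i (PBr p q) \<longleftrightarrow> i < h \<and> bounded h (2 * i) p \<and> bounded h (2 * i + 1) q"
| "bounded h i (PDer p) \<longleftrightarrow> bounded h i p"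

lemma rules_bounded: "p \<in> set rules \<Longrightarrow> bounded 1024 1 p"
  by (auto simp: rules_def Let_def rule_def)

lemma bounded_less: "bounded h i p \<Longrightarrow> i < h"
  by (induction p arbitrary: i) auto

lemma pvars_bounded: "bounded h i p \<Longrightarrow> v \<in> pvars p \<Longrightarrow> v < h"
  by (induction p arbitrary: i) auto

section \<open>Finite structures unfolding into derivations\<close>

text \<open>Nodes of a pattern are addressed by heap numbers: the root is 1, and node i has children
  2 * i and 2 * i + 1.  Indices 0, 1, 2 are the universally quantified elements, path_ix and pvar_ix the
  existentially quantified ones of a rule instance, goal_ix and num_ix the constants.\<close>

definition path_bound :: nat where "path_bound = 1024"

definition path_ix :: "nat \<Rightarrow> nat" where "path_ix i = 3 + 2 * i"
definition pvar_ix :: "nat \<Rightarrow> nat" where "pvar_ix i = 4 + 2 * i"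
definition goal_ix :: "nat \<Rightarrow> nat" where "goal_ix i = 3 + 2 * path_bound + i"
definition num_ix :: "nat \<Rightarrow> nat" where "num_ix k = 7 + 2 * path_bound + k"

text \<open>The element at \<open>path_ix i\<close> plays the subpattern at heap address
  \<open>i\<close>. A marked node must lie below the root in \<open>lt\<close>, which is what later
  drives the well-founded induction.\<close>

fun fits :: "('a \<Rightarrow> 'a \<Rightarrow> bool) \<Rightarrow> ('a \<Rightarrow> 'a \<Rightarrow> bool) \<Rightarrow> ('a \<Rightarrow> 'a \<Rightarrow> bool) \<Rightarrow> ('a \<Rightarrow> bool) \<Rightarrow>
    (nat \<Rightarrow> 'a) \<Rightarrow> nat \<Rightarrow> pat \<Rightarrow> bool" where
  "fits L R lt D \<tau> i (PVar v) \<longleftrightarrow> \<tau> (path_ix i) = \<tau> (pvar_ix v)"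
| "fits L R lt D \<tau> i (PNum k) \<longleftrightarrow> \<tau> (path_ix i) = \<tau> (num_ix k)"
| "fits L R lt D \<tau> i (PBr p q) \<longleftrightarrow>
     L (\<tau> (path_ix i)) (\<tau> (path_ix (2 * i))) \<and> R (\<tau> (path_ix i)) (\<tau> (path_ix (2 * i + 1))) \<and>
     fits L R lt D \<tau> (2 * i) p \<and> fits L R lt D \<tau> (2 * i + 1) q"
| "fits L R lt D \<tau> i (PDer p) \<longleftrightarrow>
     D (\<tau> (path_ix i)) \<and> lt (\<tau> (path_ix i)) (\<tau> (path_ix 1)) \<and> fits L R lt D \<tau> i p"

text \<open>Apart from constants and existential witnesses, no axiom speaks of more than three
  elements; with four vertices each, this accounts for twelve universal quantifiers.\<close>

locale derivation_structure =
  fixes A :: "'a set" and L R lt :: "'a \<Rightarrow> 'a \<Rightarrow> bool" and D :: "'a \<Rightarrow> bool"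
    and c :: "nat \<Rightarrow> 'a" and K :: nat
  assumes finite_A: "finite A"
    and less_irrefl: "x \<in> A \<Longrightarrow> \<not> lt x x"
    and less_trans: "x \<in> A \<Longrightarrow> y \<in> A \<Longrightarrow> z \<in> A \<Longrightarrow> lt x y \<Longrightarrow> lt y z \<Longrightarrow> lt x z"
    and L_less: "x \<in> A \<Longrightarrow> y \<in> A \<Longrightarrow> L x y \<Longrightarrow> lt y x"
    and R_less: "x \<in> A \<Longrightarrow> y \<in> A \<Longrightarrow> R x y \<Longrightarrow> lt y x"
    and L_unique: "x \<in> A \<Longrightarrow> y \<in> A \<Longrightarrow> z \<in> A \<Longrightarrow> L x y \<Longrightarrow> L x z \<Longrightarrow> y = z"
    and R_unique: "x \<in> A \<Longrightarrow> y \<in> A \<Longrightarrow> z \<in> A \<Longrightarrow> R x y \<Longrightarrow> R x z \<Longrightarrow> y = z"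
    and zero: "x \<in> A \<Longrightarrow> \<not> L (c 0) x"
    and c_in: "k \<le> K \<Longrightarrow> c k \<in> A"
    and c_Suc: "k < K \<Longrightarrow> L (c (Suc k)) (c 0)" "k < K \<Longrightarrow> R (c (Suc k)) (c k)"
    and K_ge: "11 \<le> K"
    and D_rule: "x \<in> A \<Longrightarrow> D x \<Longrightarrow> \<exists>\<tau>. \<tau> (path_ix 1) = x \<and> (\<forall>i<path_bound. \<tau> (path_ix i) \<in> A \<and> \<tau> (pvar_ix i) \<in> A) \<and>
        (\<forall>k\<le>11. \<tau> (num_ix k) = c k) \<and> (\<exists>p\<in>set rules. fits L R lt D \<tau> 1 p)"
begin

definition below :: "('a \<times> 'a) set" where
  "below = {(y, x). y \<in> A \<and> x \<in> A \<and> lt y x}"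

lemma wf_below: "wf below"
proof (rule finite_acyclic_wf)
  show "finite below"
    by (rule finite_subset[of _ "A \<times> A"]) (auto simp: below_def finite_A)
  have "trans below"
    unfolding below_def by (rule transI) (auto intro: less_trans)
  then show "acyclic below"
    by (auto simp: acyclic_def trancl_id below_def less_irrefl)
qed

text \<open>Unfolds an element into a tree. The choices are forced by uniqueness of \<open>L\<close>
  and \<open>R\<close>, and the recursion is well founded since both descend along
  \<open>lt\<close>. An element lacking a child becomes \<open>Tip\<close>; different elements may
  yield equal trees.\<close>

definition val :: "'a \<Rightarrow> tree" where
  "val = wfrec below (\<lambda>f x. if \<exists>y\<in>A. \<exists>z\<in>A. L x y \<and> R x z
     then Br (f (SOME y. y \<in> A \<and> L x y)) (f (SOME z. z \<in> A \<and> R x z)) else Tip)"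

lemma val_Br:
  assumes "x \<in> A" "y \<in> A" "z \<in> A" "L x y" "R x z"
  shows "val x = Br (val y) (val z)"
proof -
  have "(SOME y. y \<in> A \<and> L x y) = y" "(SOME z. z \<in> A \<and> R x z) = z"
    using assms L_unique R_unique by blast+
  moreover have "(y, x) \<in> below" "(z, x) \<in> below"
    using assms L_less R_less by (auto simp: below_def)
  ultimately show ?thesis
    using assms unfolding val_def by (subst wfrec[OF wf_below]) (auto simp: cut_apply)
qed

lemma val_c: "k \<le> K \<Longrightarrow> val (c k) = num k"
proof (induction k)
  case 0
  then show ?case
    unfolding val_def using zero by (subst wfrec[OF wf_below]) auto
next
  case (Suc k)
  have "val (c 0) = Tip"
    unfolding val_def using zero by (subst wfrec[OF wf_below]) auto
  then show ?case
    using Suc val_Br[of "c (Suc k)" "c 0" "c k"] c_in c_Suc[of k] by auto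
qed

text \<open>A match inside the structure unfolds to an instance of the pattern, and each mark to an
  element of \<open>D\<close> below the root.\<close>

lemma fits_val:
  assumes "\<forall>i<path_bound. \<tau> (path_ix i) \<in> A \<and> \<tau> (pvar_ix i) \<in> A" "\<forall>k\<le>11. \<tau> (num_ix k) = c k"
  defines "\<sigma> \<equiv> \<lambda>v. val (\<tau> (pvar_ix v))"
  shows "fits L R lt D \<tau> i p \<Longrightarrow> bounded path_bound i p \<Longrightarrow> val (\<tau> (path_ix i)) = inst \<sigma> p \<and>
    (\<forall>q\<in>marked p. \<exists>y\<in>A. D y \<and> lt y (\<tau> (path_ix 1)) \<and> val y = inst \<sigma> q)"
proof (induction p arbitrary: i)
  case (PVar v)
  then show ?case by (simp add: \<sigma>_def)
next
  case (PNum n)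
  then show ?case using assms(2) K_ge by (simp add: val_c)
next
  case (PBr p q)
  have "2 * i < path_bound" "2 * i + 1 < path_bound"
    using PBr.prems(2) by (auto dest: bounded_less)
  then have "val (\<tau> (path_ix i)) = Br (val (\<tau> (path_ix (2 * i)))) (val (\<tau> (path_ix (2 * i + 1))))"
    using PBr.prems assms(1) by (intro val_Br) auto
  then show ?case using PBr by auto
next
  case (PDer p)
  then show ?case using assms(1) bounded_less by auto
qed

text \<open>Well-founded induction along \<open>lt\<close>: the marked parts of the matched rule
  come from smaller elements of \<open>D\<close>, hence are valid already.\<close>

theorem D_valid: "x \<in> A \<Longrightarrow> D x \<Longrightarrow> valid (val x)"
proof (induction x rule: wf_induct_rule[OF wf_below])
  case (1 x)
  then obtain \<tau> p where \<tau>: "\<tau> (path_ix 1) = x" "\<forall>i<path_bound. \<tau> (path_ix i) \<in> A \<and> \<tau> (pvar_ix i) \<in> A"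
    "\<forall>k\<le>11. \<tau> (num_ix k) = c k" "p \<in> set rules" "fits L R lt D \<tau> 1 p"
    using D_rule[OF 1(2,3)] by blast
  have "bounded path_bound 1 p" using \<tau>(4) rules_bounded by (simp add: path_bound_def)
  from fits_val[OF \<tau>(2,3,5) this] show ?case
    using 1 \<tau>(1,4) valid.intros[OF \<tau>(4), of "\<lambda>v. val (\<tau> (pvar_ix v))"]
    by (auto simp: below_def) metis
qed

end

section \<open>The sentences\<close>

text \<open>The closing \<open>Eq 0 0\<close> is truth. It makes variable 0 free in every
  conjunction, which does no harm because 0 is a marker and is quantified in
  \<open>phi\<close>.\<close>

definition conj :: "fm list \<Rightarrow> fm" where
  "conj ps = foldr Conj ps (Eq 0 0)"

definition disj :: "fm list \<Rightarrow> fm" where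
  "disj ps = foldr Disj ps (Neg (Eq 0 0))"

lemma sat_conj [simp]: "sat V E a (conj ps) \<longleftrightarrow> (\<forall>p\<in>set ps. sat V E a p)"
  by (induction ps) (auto simp: conj_def)

lemma sat_disj [simp]: "sat V E a (disj ps) \<longleftrightarrow> (\<exists>p\<in>set ps. sat V E a p)"
  by (induction ps) (auto simp: disj_def)

lemma freevars_conj: "freevars (conj ps) = insert 0 (\<Union>p\<in>set ps. freevars p)"
  by (induction ps) (auto simp: conj_def)

lemma freevars_disj: "freevars (disj ps) = insert 0 (\<Union>p\<in>set ps. freevars p)"
  by (induction ps) (auto simp: disj_def)

lemma qfree_conj [simp]: "qfree (conj ps) \<longleftrightarrow> (\<forall>p\<in>set ps. qfree p)"
  by (induction ps) (auto simp: conj_def)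

lemma qfree_disj [simp]: "qfree (disj ps) \<longleftrightarrow> (\<forall>p\<in>set ps. qfree p)"
  by (induction ps) (auto simp: disj_def)

section \<open>Blocks of quantifiers\<close>

fun exs :: "nat \<Rightarrow> nat \<Rightarrow> fm \<Rightarrow> fm" where
  "exs s 0 p = p"
| "exs s (Suc n) p = Ex (s + n) (exs s n p)"

fun alls :: "nat \<Rightarrow> nat \<Rightarrow> fm \<Rightarrow> fm" where
  "alls s 0 p = p"
| "alls s (Suc n) p = All (s + n) (alls s n p)"

lemma freevars_exs [simp]: "freevars (exs s n p) = freevars p - {s..<s + n}"
proof (induction n)
  case (Suc n)
  have "{s..<s + Suc n} = insert (s + n) {s..<s + n}" by auto
  with Suc show ?case by (simp only: exs.simps freevars.simps) blast
qed simp

lemma freevars_alls [simp]: "freevars (alls s n p) = freevars p - {s..<s + n}"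
proof (induction n)
  case (Suc n)
  have "{s..<s + Suc n} = insert (s + n) {s..<s + n}" by auto
  with Suc show ?case by (simp only: alls.simps freevars.simps) blast
qed simp

lemma qprefix_exs [simp]: "qprefix (exs s n p) = replicate n True @ qprefix p"
  by (induction n) auto

lemma qprefix_alls [simp]: "qprefix (alls s n p) = replicate n False @ qprefix p"
  by (induction n) auto

lemma matrix_exs [simp]: "matrix (exs s n p) = matrix p"
  by (induction n) auto

lemma matrix_alls [simp]: "matrix (alls s n p) = matrix p"
  by (induction n) auto

text \<open>Turns a block of quantifiers into a single quantifier over assignments.\<close>

definition varies :: "nat set \<Rightarrow> nat \<Rightarrow> nat \<Rightarrow> (nat \<Rightarrow> nat) \<Rightarrow> (nat \<Rightarrow> nat) \<Rightarrow> bool" where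
  "varies V s n a b \<longleftrightarrow> (\<forall>i. if s \<le> i \<and> i < s + n then b i \<in> V else b i = a i)"

lemma varies_0 [simp]: "varies V s 0 a b \<longleftrightarrow> b = a"
  by (auto simp: varies_def)

lemma varies_Suc: "varies V s (Suc n) a b \<longleftrightarrow> (\<exists>v\<in>V. varies V s n (a(s + n := v)) b)"
proof
  assume *: "varies V s (Suc n) a b"
  have "varies V s n (a(s + n := b (s + n))) b"
    unfolding varies_def
  proof
    fix i
    show "if s \<le> i \<and> i < s + n then b i \<in> V else b i = (a(s + n := b (s + n))) i"
      using *[unfolded varies_def, rule_format, of i] by (auto split: if_splits)
  qed
  moreover have "b (s + n) \<in> V"
    using *[unfolded varies_def, rule_format, of "s + n"] by simp
  ultimately show "\<exists>v\<in>V. varies V s n (a(s + n := v)) b" by blast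
next
  assume "\<exists>v\<in>V. varies V s n (a(s + n := v)) b"
  then obtain v where v: "v \<in> V" "varies V s n (a(s + n := v)) b" by blast
  show "varies V s (Suc n) a b"
    unfolding varies_def
  proof
    fix i
    show "if s \<le> i \<and> i < s + Suc n then b i \<in> V else b i = a i"
      using v(1) v(2)[unfolded varies_def, rule_format, of i] by (auto split: if_splits)
  qed
qed

lemma sat_exs [simp]: "sat V E a (exs s n p) \<longleftrightarrow> (\<exists>b. varies V s n a b \<and> sat V E b p)"
  by (induction n arbitrary: a) (auto simp: varies_Suc)

lemma sat_alls [simp]: "sat V E a (alls s n p) \<longleftrightarrow> (\<forall>b. varies V s n a b \<longrightarrow> sat V E b p)"
  by (induction n arbitrary: a) (auto simp: varies_Suc)

text \<open>Variables 0, 1, 2, 3 are the markers of the four copies and 4 marks the valid derivations;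
  the element with index i is the quadruple of the variables var_of i 0, ..., var_of i 3.\<close>

definition var_of :: "nat \<Rightarrow> nat \<Rightarrow> nat" where
  "var_of i c = 5 + 4 * i + c"

text \<open>The edges to the markers fix the layer of each vertex; the edges from copy 0 tie the
  other copies to the same element.\<close>

definition fNode :: "nat \<Rightarrow> fm" where
  "fNode i = conj [Rel (var_of i 0) 0, Rel (var_of i 1) 1, Rel (var_of i 2) 2, Rel (var_of i 3) 3,
     Rel (var_of i 0) (var_of i 1), Rel (var_of i 0) (var_of i 2), Rel (var_of i 0) (var_of i 3)]"

text \<open>Edges are symmetric, but the two ends lie in different layers, so they can be told apart
  and the coded relation is directed.\<close>

definition fL :: "nat \<Rightarrow> nat \<Rightarrow> fm" where "fL i j = Rel (var_of i 1) (var_of j 2)"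
definition fR :: "nat \<Rightarrow> nat \<Rightarrow> fm" where "fR i j = Rel (var_of i 1) (var_of j 3)"
definition fLt :: "nat \<Rightarrow> nat \<Rightarrow> fm" where "fLt i j = Rel (var_of i 2) (var_of j 3)"
definition fD :: "nat \<Rightarrow> fm" where "fD i = Rel (var_of i 0) 4"
definition fEq :: "nat \<Rightarrow> nat \<Rightarrow> fm" where
  "fEq i j = conj [Eq (var_of i 0) (var_of j 0), Eq (var_of i 1) (var_of j 1), Eq (var_of i 2) (var_of j 2), Eq (var_of i 3) (var_of j 3)]"

fun fFits :: "nat \<Rightarrow> pat \<Rightarrow> fm" where
  "fFits i (PVar v) = fEq (path_ix i) (pvar_ix v)"
| "fFits i (PNum k) = fEq (path_ix i) (num_ix k)"
| "fFits i (PBr p q) = conj [fL (path_ix i) (path_ix (2 * i)), fR (path_ix i) (path_ix (2 * i + 1)),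
     fFits (2 * i) p, fFits (2 * i + 1) q]"
| "fFits i (PDer p) = conj [fD (path_ix i), fLt (path_ix i) (path_ix 1), fFits i p]"

text \<open>Constant \<open>goal_ix 0\<close> is the derivation, \<open>goal_ix 1\<close> its
  conclusion, \<open>goal_ix 2\<close> the pair of input and output, and \<open>goal_ix 3\<close>
  the premises. The program is numeral 7, which is \<open>tDiag\<close>, and the output is numeral
  0. Nothing here depends on \<open>e\<close>.\<close>

definition core :: fm where
  "core = conj
    [Imp (conj [fNode 0, fNode 1, fNode 2]) (conj
      [Neg (fLt 0 0), Imp (conj [fLt 0 1, fLt 1 2]) (fLt 0 2),
       Imp (fL 0 1) (fLt 1 0), Imp (fR 0 1) (fLt 1 0),
       Imp (conj [fL 0 1, fL 0 2]) (fEq 1 2), Imp (conj [fR 0 1, fR 0 2]) (fEq 1 2),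
       Neg (fL (num_ix 0) 0),
       Imp (fD 0) (conj [conj (map fNode [3..<3 + 2 * path_bound]), fEq (path_ix 1) 0, disj (map (fFits 1) rules)])]),
     conj (map fNode [goal_ix 0, goal_ix 1, goal_ix 2, goal_ix 3]), fD (goal_ix 0), fL (goal_ix 0) (goal_ix 1), fR (goal_ix 0) (goal_ix 3),
     fL (goal_ix 1) (num_ix 7), fR (goal_ix 1) (goal_ix 2), fR (goal_ix 2) (num_ix 0)]"

fun chain :: "nat \<Rightarrow> fm" where
  "chain 0 = fNode (num_ix 0)"
| "chain (Suc n) = Conj (conj [fNode (num_ix (Suc n)), fL (num_ix (Suc n)) (num_ix 0), fR (num_ix (Suc n)) (num_ix n)]) (chain n)"

definition body :: "nat \<Rightarrow> fm" where
  "body e = Conj core (Conj (fL (goal_ix 2) (num_ix e)) (chain (e + 11)))"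

text \<open>There are \<open>e + 16\<close> constant quadruples: four goals and the numerals 0 to
  \<open>e + 11\<close>. Then come five markers, three universal quadruples, and
  \<open>2 * path_bound\<close> quadruples of witnesses.\<close>

definition phi :: "nat \<Rightarrow> fm" where
  "phi e = exs (var_of (goal_ix 0) 0) (4 * (e + 16)) (exs 0 5 (alls 5 12 (exs 17 (8 * path_bound) (body e))))"

section \<open>Semantics in terms of quadruples of vertices\<close>

type_synonym quad = "nat \<times> nat \<times> nat \<times> nat"

definition tup :: "(nat \<Rightarrow> nat) \<Rightarrow> nat \<Rightarrow> quad" where
  "tup a i = (a (var_of i 0), a (var_of i 1), a (var_of i 2), a (var_of i 3))"

fun qNode :: "(nat \<Rightarrow> nat \<Rightarrow> bool) \<Rightarrow> (nat \<Rightarrow> nat) \<Rightarrow> quad \<Rightarrow> bool" where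
  "qNode E m (p, q, r, s) \<longleftrightarrow>
     E p (m 0) \<and> E q (m 1) \<and> E r (m 2) \<and> E s (m 3) \<and> E p q \<and> E p r \<and> E p s"
fun qL :: "(nat \<Rightarrow> nat \<Rightarrow> bool) \<Rightarrow> quad \<Rightarrow> quad \<Rightarrow> bool" where
  "qL E (p, q, r, s) (p', q', r', s') \<longleftrightarrow> E q r'"
fun qR :: "(nat \<Rightarrow> nat \<Rightarrow> bool) \<Rightarrow> quad \<Rightarrow> quad \<Rightarrow> bool" where
  "qR E (p, q, r, s) (p', q', r', s') \<longleftrightarrow> E q s'"
fun qLt :: "(nat \<Rightarrow> nat \<Rightarrow> bool) \<Rightarrow> quad \<Rightarrow> quad \<Rightarrow> bool" where
  "qLt E (p, q, r, s) (p', q', r', s') \<longleftrightarrow> E r s'"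
fun qD :: "(nat \<Rightarrow> nat \<Rightarrow> bool) \<Rightarrow> (nat \<Rightarrow> nat) \<Rightarrow> quad \<Rightarrow> bool" where
  "qD E m (p, q, r, s) \<longleftrightarrow> E p (m 4)"

lemma sat_quad [simp]:
  "sat V E a (fNode i) \<longleftrightarrow> qNode E a (tup a i)"
  "sat V E a (fL i j) \<longleftrightarrow> qL E (tup a i) (tup a j)"
  "sat V E a (fR i j) \<longleftrightarrow> qR E (tup a i) (tup a j)"
  "sat V E a (fLt i j) \<longleftrightarrow> qLt E (tup a i) (tup a j)"
  "sat V E a (fD i) \<longleftrightarrow> qD E a (tup a i)"
  "sat V E a (fEq i j) \<longleftrightarrow> tup a i = tup a j"
  by (auto simp: fNode_def fL_def fR_def fLt_def fD_def fEq_def tup_def)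

lemma sat_fFits [simp]:
  "sat V E a (fFits i p) \<longleftrightarrow> fits (qL E) (qR E) (qLt E) (qD E a) (tup a) i p"
  by (induction p arbitrary: i) auto

lemma sat_chain [simp]:
  "sat V E a (chain n) \<longleftrightarrow> (\<forall>k\<le>n. qNode E a (tup a (num_ix k))) \<and>
     (\<forall>k<n. qL E (tup a (num_ix (Suc k))) (tup a (num_ix 0)) \<and> qR E (tup a (num_ix (Suc k))) (tup a (num_ix k)))"
  by (induction n) (auto simp: le_Suc_eq less_Suc_eq)

lemma qNode_cong: "(\<And>i. i < 5 \<Longrightarrow> m i = m' i) \<Longrightarrow> qNode E m x \<longleftrightarrow> qNode E m' x"
  by (cases x) auto

lemma qD_cong: "(\<And>i. i < 5 \<Longrightarrow> m i = m' i) \<Longrightarrow> qD E m x \<longleftrightarrow> qD E m' x"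
  by (cases x) auto

section \<open>Free variables and the quantifier prefix\<close>

lemma qfree_fFits: "qfree (fFits i p)"
  by (induction p arbitrary: i) (auto simp: fL_def fR_def fLt_def fD_def fEq_def)

lemma qfree_body: "qfree (body e)"
proof -
  have "qfree (chain n)" for n
    by (induction n) (auto simp: fNode_def fL_def fR_def)
  then show ?thesis
    by (auto simp: body_def core_def fNode_def fL_def fR_def fLt_def fD_def fEq_def qfree_fFits)
qed

lemma freevars_quad:
  assumes "i < n" "j < n"
  shows "freevars (fNode i) \<subseteq> {..<var_of n 0}" "freevars (fL i j) \<subseteq> {..<var_of n 0}"
    "freevars (fR i j) \<subseteq> {..<var_of n 0}" "freevars (fLt i j) \<subseteq> {..<var_of n 0}"
    "freevars (fD i) \<subseteq> {..<var_of n 0}" "freevars (fEq i j) \<subseteq> {..<var_of n 0}"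
  using assms by (auto simp: fNode_def fL_def fR_def fLt_def fD_def fEq_def freevars_conj var_of_def)

lemma freevars_conj_le [simp]:
  "freevars (conj ps) \<subseteq> {..<m} \<longleftrightarrow> 0 < m \<and> (\<forall>p\<in>set ps. freevars p \<subseteq> {..<m})"
  "freevars (disj ps) \<subseteq> {..<m} \<longleftrightarrow> 0 < m \<and> (\<forall>p\<in>set ps. freevars p \<subseteq> {..<m})"
  unfolding freevars_conj freevars_disj by auto

lemma freevars_fFits: "bounded path_bound i p \<Longrightarrow> freevars (fFits i p) \<subseteq> {..<var_of (num_ix 12) 0}"
proof (induction p arbitrary: i)
  case (PBr p q)
  then have "2 * i < path_bound" "2 * i + 1 < path_bound" by (auto dest: bounded_less)
  with PBr show ?case
    by (auto simp: var_of_def fL_def fR_def path_ix_def num_ix_def)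
next
  case (PDer p)
  then have "i < path_bound" by (auto dest: bounded_less)
  with PDer show ?case
    by (auto simp: var_of_def fD_def fLt_def path_ix_def num_ix_def path_bound_def)
qed (auto simp: fEq_def freevars_conj var_of_def path_ix_def pvar_ix_def num_ix_def)

lemma freevars_chain: "freevars (chain n) \<subseteq> {..<var_of (num_ix (Suc n)) 0}"
proof (induction n)
  case (Suc n)
  then show ?case
    by (auto simp: fNode_def fL_def fR_def freevars_conj var_of_def num_ix_def)
qed (auto simp: fNode_def freevars_conj var_of_def num_ix_def)

lemma freevars_body: "freevars (body e) \<subseteq> {..<var_of (num_ix (e + 12)) 0}"
proof -
  have "freevars core \<subseteq> {..<var_of (num_ix 12) 0}"
  proof -
    have "freevars (fFits 1 p) \<subseteq> {..<var_of (num_ix 12) 0}" if "p \<in> set rules" for p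
      using rules_bounded[OF that] by (intro freevars_fFits) (simp add: path_bound_def)
    moreover have "0 < var_of (num_ix 12) 0" "path_ix 1 < num_ix 12" "num_ix 0 < num_ix 12" "num_ix 7 < num_ix 12"
      "goal_ix 0 < num_ix 12" "goal_ix 1 < num_ix 12" "goal_ix 2 < num_ix 12" "goal_ix 3 < num_ix 12"
      "0 < num_ix 12" "1 < num_ix 12" "2 < num_ix 12" "\<And>i. i < 3 + 2 * path_bound \<Longrightarrow> i < num_ix 12"
      by (auto simp: var_of_def num_ix_def path_ix_def goal_ix_def path_bound_def)
    ultimately show ?thesis
      by (simp add: core_def freevars_quad)
  qed
  moreover have "freevars (fL (goal_ix 2) (num_ix e)) \<subseteq> {..<var_of (num_ix (e + 12)) 0}"
    by (intro freevars_quad) (auto simp: goal_ix_def num_ix_def)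
  moreover have "var_of (num_ix 12) 0 \<le> var_of (num_ix (e + 12)) 0" by (auto simp: var_of_def num_ix_def)
  moreover have "freevars (chain (e + 11)) \<subseteq> {..<var_of (num_ix (e + 12)) 0}"
    using freevars_chain[of "e + 11"] by (simp add: add.commute)
  ultimately show ?thesis
    by (auto simp: body_def)
qed

lemma phi_class:
  "sentence (phi e)" "prenex (phi e)"
  "\<exists>j. qprefix (phi e) = replicate j True @ replicate 12 False @ replicate (8 * path_bound) True @ replicate 0 False"
proof -
  have "var_of (num_ix (e + 12)) 0 = var_of (goal_ix 0) 0 + 4 * (e + 16)" by (simp add: var_of_def num_ix_def goal_ix_def)
  moreover have "var_of (goal_ix 0) 0 = 17 + 8 * path_bound" by (simp add: var_of_def goal_ix_def)
  ultimately show "sentence (phi e)"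
    using freevars_body[of e] unfolding sentence_def phi_def by auto
  show "prenex (phi e)"
    using qfree_body[of e] unfolding prenex_def phi_def by (simp add: body_def)
  have "qprefix (body e) = []" by (simp add: body_def)
  then show "\<exists>j. qprefix (phi e) = replicate j True @ replicate 12 False @ replicate (8 * path_bound) True @ replicate 0 False"
    unfolding phi_def
    by (intro exI[of _ "4 * (e + 16) + 5"]) (simp flip: append_assoc replicate_add)
qed

section \<open>Models yield derivations\<close>

lemma tup_eqI: "(\<And>c. c < 4 \<Longrightarrow> a (var_of i c) = b (var_of j c)) \<Longrightarrow> tup a i = tup b j"
  by (simp add: tup_def)

lemma sat_body:
  "sat V E a (body e) \<longleftrightarrow>
    (qNode E a (tup a 0) \<and> qNode E a (tup a 1) \<and> qNode E a (tup a 2) \<longrightarrow>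
      \<not> qLt E (tup a 0) (tup a 0) \<and>
      (qLt E (tup a 0) (tup a 1) \<and> qLt E (tup a 1) (tup a 2) \<longrightarrow> qLt E (tup a 0) (tup a 2)) \<and>
      (qL E (tup a 0) (tup a 1) \<longrightarrow> qLt E (tup a 1) (tup a 0)) \<and>
      (qR E (tup a 0) (tup a 1) \<longrightarrow> qLt E (tup a 1) (tup a 0)) \<and>
      (qL E (tup a 0) (tup a 1) \<and> qL E (tup a 0) (tup a 2) \<longrightarrow> tup a 1 = tup a 2) \<and>
      (qR E (tup a 0) (tup a 1) \<and> qR E (tup a 0) (tup a 2) \<longrightarrow> tup a 1 = tup a 2) \<and>
      \<not> qL E (tup a (num_ix 0)) (tup a 0) \<and>
      (qD E a (tup a 0) \<longrightarrow> (\<forall>i\<in>{3..<3 + 2 * path_bound}. qNode E a (tup a i)) \<and>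
        tup a (path_ix 1) = tup a 0 \<and> (\<exists>p\<in>set rules. fits (qL E) (qR E) (qLt E) (qD E a) (tup a) 1 p))) \<and>
    (qNode E a (tup a (goal_ix 0)) \<and> qNode E a (tup a (goal_ix 1)) \<and> qNode E a (tup a (goal_ix 2)) \<and>
      qNode E a (tup a (goal_ix 3))) \<and> qD E a (tup a (goal_ix 0)) \<and>
    qL E (tup a (goal_ix 0)) (tup a (goal_ix 1)) \<and> qR E (tup a (goal_ix 0)) (tup a (goal_ix 3)) \<and>
    qL E (tup a (goal_ix 1)) (tup a (num_ix 7)) \<and> qR E (tup a (goal_ix 1)) (tup a (goal_ix 2)) \<and>
    qR E (tup a (goal_ix 2)) (tup a (num_ix 0)) \<and> qL E (tup a (goal_ix 2)) (tup a (num_ix e)) \<and>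
    (\<forall>k\<le>e + 11. qNode E a (tup a (num_ix k))) \<and>
    (\<forall>k<e + 11. qL E (tup a (num_ix (Suc k))) (tup a (num_ix 0)) \<and> qR E (tup a (num_ix (Suc k))) (tup a (num_ix k)))"
  unfolding body_def core_def by simp

text \<open>The quadruples satisfying \<open>qNode\<close> form a derivation structure. Unfolding
  the goal constant gives a valid derivation whose conclusion is the claim.\<close>

lemma phi_sound:
  assumes G: "finite_graph V E" and true: "true_in V E (phi e)"
  shows "ev tDiag (num e) Tip"
proof -
  have EV: "E x y \<Longrightarrow> x \<in> V \<and> y \<in> V" for x y
    using G by (auto simp: finite_graph_def)
  obtain v where v: "v \<in> V" using G by (auto simp: finite_graph_def)
  then have "sat V E (\<lambda>_. v) (phi e)"
    using true by (auto simp: true_in_def)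
  then obtain b1 b where b1: "varies V (var_of (goal_ix 0) 0) (4 * (e + 16)) (\<lambda>_. v) b1"
    and b: "varies V 0 5 b1 b"
    and all: "\<And>b'. varies V 5 12 b b' \<Longrightarrow> \<exists>b''. varies V 17 (8 * path_bound) b' b'' \<and> sat V E b'' (body e)"
    by (auto simp: phi_def)
  have bV: "b i \<in> V" for i
    using b b1 v unfolding varies_def by metis
  let ?Q = "V \<times> V \<times> V \<times> V"
  \<comment> \<open>Any three quadruples may serve as the universal elements, while the markers and
    constants keep the values fixed by \<open>b\<close>.\<close>
  have key: "\<exists>a. (\<forall>i<5. a i = b i) \<and> tup a 0 = x \<and> tup a 1 = y \<and> tup a 2 = z \<and>
      (\<forall>i\<ge>3 + 2 * path_bound. tup a i = tup b i) \<and> sat V E a (body e)"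
    if Q: "x \<in> ?Q" "y \<in> ?Q" "z \<in> ?Q" for x y z
  proof -
    obtain x0 x1 x2 x3 y0 y1 y2 y3 z0 z1 z2 z3
      where xyz: "x = (x0, x1, x2, x3)" "y = (y0, y1, y2, y3)" "z = (z0, z1, z2, z3)"
      by (cases x; cases y; cases z) auto
    define b' where "b' = b(5 := x0, 6 := x1, 7 := x2, 8 := x3, 9 := y0, 10 := y1, 11 := y2, 12 := y3,
      13 := z0, 14 := z1, 15 := z2, 16 := z3)"
    have "varies V 5 12 b b'"
      using Q bV unfolding varies_def b'_def xyz by auto
    then obtain a where a: "varies V 17 (8 * path_bound) b' a" "sat V E a (body e)"
      using all by blast
    have low: "a i = b' i" if "i < 17" for i
      using a(1) that by (auto simp: varies_def)
    have high: "a i = b i" if "17 + 8 * path_bound \<le> i" for i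
      using a(1) that by (auto simp: varies_def b'_def)
    show ?thesis
    proof (intro exI[of _ a] conjI allI impI)
      fix i assume "i \<ge> 3 + 2 * path_bound"
      then show "tup a i = tup b i"
        by (intro tup_eqI high) (auto simp: var_of_def)
    qed (use a low in \<open>auto simp: tup_def var_of_def b'_def xyz\<close>)
  qed
  define A where "A = {x. qNode E b x}"
  define c where "c k = tup b (num_ix k)" for k
  have AQ: "x \<in> ?Q" if "x \<in> A" for x
    using that EV by (cases x) (auto simp: A_def)
  have num_ix_ge: "num_ix k \<ge> 3 + 2 * path_bound" "goal_ix k \<ge> 3 + 2 * path_bound" for k
    by (auto simp: num_ix_def goal_ix_def)
  have congs: "qNode E a = qNode E b" "qD E a = qD E b" if "\<forall>i<5. a i = b i" for a
    using that by (auto intro!: ext qNode_cong qD_cong)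
  have ax: "\<not> qLt E x x \<and> (qLt E x y \<and> qLt E y z \<longrightarrow> qLt E x z) \<and>
      (qL E x y \<longrightarrow> qLt E y x) \<and> (qR E x y \<longrightarrow> qLt E y x) \<and>
      (qL E x y \<and> qL E x z \<longrightarrow> y = z) \<and> (qR E x y \<and> qR E x z \<longrightarrow> y = z) \<and> \<not> qL E (c 0) x \<and>
      (qD E b x \<longrightarrow> (\<exists>\<tau>. \<tau> (path_ix 1) = x \<and> (\<forall>i<path_bound. \<tau> (path_ix i) \<in> A \<and> \<tau> (pvar_ix i) \<in> A) \<and>
        (\<forall>k\<le>11. \<tau> (num_ix k) = c k) \<and> (\<exists>p\<in>set rules. fits (qL E) (qR E) (qLt E) (qD E b) \<tau> 1 p)))"
    if "x \<in> A" "y \<in> A" "z \<in> A" for x y z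
  proof -
    obtain a where a: "\<forall>i<5. a i = b i" "tup a 0 = x" "tup a 1 = y" "tup a 2 = z"
      "\<forall>i\<ge>3 + 2 * path_bound. tup a i = tup b i" "sat V E a (body e)"
      using key[OF AQ[OF \<open>x \<in> A\<close>] AQ[OF \<open>y \<in> A\<close>] AQ[OF \<open>z \<in> A\<close>]] by blast
    have c: "tup a (num_ix k) = c k" for k using a(5) num_ix_ge by (simp add: c_def)
    have w: "3 \<le> path_ix i \<and> path_ix i < 3 + 2 * path_bound \<and> 3 \<le> pvar_ix i \<and> pvar_ix i < 3 + 2 * path_bound" if "i < path_bound" for i
      using that by (auto simp: path_ix_def pvar_ix_def)
    have nodes: "qNode E b x" "qNode E b y" "qNode E b z" using that by (auto simp: A_def)
    note s = a(6)[unfolded sat_body congs[OF a(1)] a(2-4) c, THEN conjunct1, rule_format, OF conjI[OF nodes(1) conjI[OF nodes(2,3)]]]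
    show ?thesis
    proof (intro conjI impI)
      assume "qD E b x"
      with s have "\<forall>i\<in>{3..<3 + 2 * path_bound}. qNode E b (tup a i)" "tup a (path_ix 1) = x"
        "\<exists>p\<in>set rules. fits (qL E) (qR E) (qLt E) (qD E b) (tup a) 1 p" by blast+
      moreover have "path_ix i \<in> {3..<3 + 2 * path_bound}" "pvar_ix i \<in> {3..<3 + 2 * path_bound}" if "i < path_bound" for i
        using w[OF that] by auto
      ultimately show "\<exists>\<tau>. \<tau> (path_ix 1) = x \<and> (\<forall>i<path_bound. \<tau> (path_ix i) \<in> A \<and> \<tau> (pvar_ix i) \<in> A) \<and>
        (\<forall>k\<le>11. \<tau> (num_ix k) = c k) \<and> (\<exists>p\<in>set rules. fits (qL E) (qR E) (qLt E) (qD E b) \<tau> 1 p)"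
        using c unfolding A_def by (intro exI[of _ "tup a"]) blast
    qed (use s in blast)+
  qed
  \<comment> \<open>Any universal values will do here, since only the clauses about constants are
    read off.\<close>
  obtain a where a: "\<forall>i<5. a i = b i" "\<forall>i\<ge>3 + 2 * path_bound. tup a i = tup b i" "sat V E a (body e)"
    using key[of "(v, v, v, v)" "(v, v, v, v)" "(v, v, v, v)"] v by blast
  have atc: "tup a (num_ix k) = c k" and atg: "tup a (goal_ix k) = tup b (goal_ix k)" for k
    using a(2) num_ix_ge by (simp_all add: c_def)
  note s = a(3)[unfolded sat_body congs[OF a(1)] atc atg, THEN conjunct2]
  have cA: "c k \<in> A" if "k \<le> e + 11" for k
    using s that unfolding A_def by blast
  interpret derivation_structure A "qL E" "qR E" "qLt E" "qD E b" c "e + 11"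
  proof (unfold_locales, goal_cases)
    case 1
    show ?case
      using G AQ by (intro finite_subset[of A ?Q]) (auto simp: finite_graph_def)
  next
    case (9 k)
    then show ?case by (rule cA)
  next
    case (2 x)
    then show ?case using ax[of x x x] by blast
  next
    case (3 x y z)
    then show ?case using ax[of x y z] by blast
  next
    case (4 x y)
    then show ?case using ax[of x y y] by blast
  next
    case (5 x y)
    then show ?case using ax[of x y y] by blast
  next
    case (6 x y z)
    then show ?case using ax[of x y z] by blast
  next
    case (7 x y z)
    then show ?case using ax[of x y z] by blast
  next
    case (8 x)
    then show ?case using ax[of x x x] by blast
  next
    case (13 x)
    then show ?case using ax[of x x x] by blast
  qed (use s in auto)
  have gA: "tup b (goal_ix i) \<in> A" if "i < 4" for i
  proof -
    have "i = 0 \<or> i = 1 \<or> i = 2 \<or> i = 3" using that by auto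
    with s show ?thesis unfolding A_def by blast
  qed
  \<comment> \<open>The goal constants unfold one level at a time; numerals 7, \<open>e\<close> and
    0 all lie within the bound \<open>e + 11\<close>.\<close>
  have "val (tup b (goal_ix 0)) = Br (val (tup b (goal_ix 1))) (val (tup b (goal_ix 3)))"
    using s gA by (intro val_Br) auto
  moreover have "val (tup b (goal_ix 1)) = Br (num 7) (val (tup b (goal_ix 2)))"
    using s gA cA by (subst val_c[symmetric, of 7], simp, intro val_Br) auto
  moreover have "val (tup b (goal_ix 2)) = Br (num e) (num 0)"
    using s gA cA by (subst (1 2) val_c[symmetric], simp, simp, intro val_Br) auto
  moreover have "valid (val (tup b (goal_ix 0)))"
    using s gA by (intro D_valid) auto
  ultimately show ?thesis
    using valid_ev by fastforce
qed

section \<open>Derivations yield models\<close>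

instance tree :: countable
  by countable_datatype

datatype vertex = Marker nat | Copy tree nat

instance vertex :: countable
  by countable_datatype

text \<open>Each arc leads from a copy to a marker or to a copy with a larger number, so forgetting
  directions loses no information.\<close>

fun arc :: "vertex \<Rightarrow> vertex \<Rightarrow> bool" where
  "arc (Copy t c) (Marker k) \<longleftrightarrow> c = k \<or> c = 0 \<and> k = 4 \<and> valid t"
| "arc (Copy s c) (Copy t d) \<longleftrightarrow>
     c = 0 \<and> d > 0 \<and> s = t \<or>
     c = 1 \<and> d = 2 \<and> (\<exists>u. s = Br t u) \<or>
     c = 1 \<and> d = 3 \<and> (\<exists>u. s = Br u t) \<or>
     c = 2 \<and> d = 3 \<and> size s < size t"
| "arc (Marker k) v \<longleftrightarrow> False"

definition vertices :: "nat \<Rightarrow> vertex set" where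
  "vertices B = Marker ` {..<5} \<union> (\<lambda>(t, c). Copy t c) ` ({t. size t \<le> B} \<times> {..<4})"

definition edge :: "nat \<Rightarrow> nat \<Rightarrow> nat \<Rightarrow> bool" where
  "edge B p q \<longleftrightarrow> (\<exists>u\<in>vertices B. \<exists>v\<in>vertices B. p = to_nat u \<and> q = to_nat v \<and> (arc u v \<or> arc v u))"

lemma finite_trees: "finite {t :: tree. size t \<le> B}"
proof (induction B)
  case 0
  have "{t :: tree. size t \<le> 0} \<subseteq> {Tip}"
    by (auto elim: tree.exhaust) (metis size_num num.simps(1) tree.exhaust tree.size(4) Suc_not_Zero add_Suc_right)
  then show ?case by (rule finite_subset) simp
next
  case (Suc B)
  have "t \<in> insert Tip ((\<lambda>(s, t). Br s t) ` ({t. size t \<le> B} \<times> {t. size t \<le> B}))"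
    if "size t \<le> Suc B" for t :: tree
    using that by (cases t) auto
  then have "{t :: tree. size t \<le> Suc B} \<subseteq>
      insert Tip ((\<lambda>(s, t). Br s t) ` ({t. size t \<le> B} \<times> {t. size t \<le> B}))" by blast
  then show ?case by (rule finite_subset) (simp add: Suc)
qed

lemma finite_vertices: "finite (vertices B)"
  unfolding vertices_def by (simp add: finite_trees)

lemma arc_irrefl: "\<not> arc v v"
  by (cases v) auto

lemma finite_graph_edge: "finite_graph (to_nat ` vertices B) (edge B)"
proof -
  have "Marker 0 \<in> vertices B" by (simp add: vertices_def)
  then show ?thesis
    by (auto simp: finite_graph_def finite_vertices edge_def arc_irrefl)
qed

definition copies :: "tree \<Rightarrow> quad" where
  "copies t = (to_nat (Copy t 0), to_nat (Copy t 1), to_nat (Copy t 2), to_nat (Copy t 3))"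

lemma copies_inject [simp]: "copies s = copies t \<longleftrightarrow> s = t"
  by (auto simp: copies_def)

lemma edge_to_nat [simp]:
  "edge B (to_nat u) (to_nat v) \<longleftrightarrow> u \<in> vertices B \<and> v \<in> vertices B \<and> (arc u v \<or> arc v u)"
  by (auto simp: edge_def)

lemma in_vertices [simp]:
  "Marker k \<in> vertices B \<longleftrightarrow> k < 5"
  "Copy t c \<in> vertices B \<longleftrightarrow> size t \<le> B \<and> c < 4"
  by (auto simp: vertices_def)

lemma quad_edge:
  assumes "size s \<le> B" "size t \<le> B"
  shows "qL (edge B) (copies s) (copies t) \<longleftrightarrow> (\<exists>u. s = Br t u)"
    "qR (edge B) (copies s) (copies t) \<longleftrightarrow> (\<exists>u. s = Br u t)"
    "qLt (edge B) (copies s) (copies t) \<longleftrightarrow> size s < size t"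
  using assms by (auto simp: copies_def)

lemma quad_mark:
  assumes "size t \<le> B" "\<And>k. k < 5 \<Longrightarrow> m k = to_nat (Marker k)"
  shows "qD (edge B) m (copies t) \<longleftrightarrow> valid t" "qNode (edge B) m (copies t)"
  using assms by (auto simp: copies_def)

text \<open>Only copies with number \<open>k\<close> are adjacent to marker \<open>k\<close> for
  \<open>k < 4\<close>, and the edges from copy 0 force all four copies to belong to one
  tree.\<close>

lemma qNode_edge:
  assumes m: "\<And>k. k < 5 \<Longrightarrow> m k = to_nat (Marker k)" and x: "qNode (edge B) m x"
  shows "\<exists>t. size t \<le> B \<and> x = copies t"
proof -
  have layer: "\<exists>t. size t \<le> B \<and> p = to_nat (Copy t k)" if pk: "edge B p (m k)" "k < 4" for p k
  proof -
    obtain u :: vertex where u: "p = to_nat u" using pk(1) unfolding edge_def by blast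
    with pk m show ?thesis by (cases u) auto
  qed
  obtain p q r s where "x = (p, q, r, s)" by (cases x)
  moreover from this x layer[of p 0] layer[of q 1] layer[of r 2] layer[of s 3]
  obtain t t1 t2 t3 where "p = to_nat (Copy t 0)" "q = to_nat (Copy t1 1)"
    "r = to_nat (Copy t2 2)" "s = to_nat (Copy t3 3)" "size t \<le> B" by auto
  ultimately have "x = copies t" using x by (auto simp: copies_def)
  with \<open>size t \<le> B\<close> show ?thesis by blast
qed

section \<open>Subtrees at heap addresses\<close>

fun lft :: "tree \<Rightarrow> tree" where
  "lft Tip = Tip"
| "lft (Br s t) = s"

fun rgt :: "tree \<Rightarrow> tree" where
  "rgt Tip = Tip"
| "rgt (Br s t) = t"

text \<open>Addresses leaving the tree yield \<open>Tip\<close>, so every address gets a tree no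
  larger than \<open>t\<close>.\<close>

fun at :: "tree \<Rightarrow> nat \<Rightarrow> tree" where
  "at t i = (if i \<le> 1 then t else if even i then lft (at t (i div 2)) else rgt (at t (i div 2)))"

declare at.simps [simp del]

lemma at_simps [simp]:
  "at t 1 = t" "at t (Suc 0) = t"
  "1 \<le> i \<Longrightarrow> at t (2 * i) = lft (at t i)"
  "1 \<le> i \<Longrightarrow> at t (Suc (2 * i)) = rgt (at t i)"
  by (subst at.simps; simp)+

lemma size_at: "size (at t i) \<le> size t"
proof (induction t i rule: at.induct)
  case (1 t i)
  have "size (lft s) \<le> size s" "size (rgt s) \<le> size s" for s
    by (cases s; simp)+
  with 1 show ?case
    by (subst at.simps) (auto intro: order_trans)
qed

text \<open>Placing at each address the subtree found there gives a match. The bound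
  \<open>B\<close> keeps these trees among the vertices, and strict decrease of marked subtrees
  gives the required order.\<close>

lemma fits_at:
  assumes \<tau>: "\<forall>i<path_bound. \<tau> (path_ix i) = copies (at t i)" "\<forall>k\<le>11. \<tau> (num_ix k) = copies (num k)"
    and B: "size t \<le> B" and m: "\<And>k. k < 5 \<Longrightarrow> m k = to_nat (Marker k)"
  shows "at t i = inst \<sigma> p \<Longrightarrow> bounded path_bound i p \<Longrightarrow> 1 \<le> i \<Longrightarrow>
    \<forall>v\<in>pvars p. \<tau> (pvar_ix v) = copies (\<sigma> v) \<Longrightarrow>
    \<forall>q\<in>marked p. valid (inst \<sigma> q) \<and> size (inst \<sigma> q) < size t \<Longrightarrow>
    fits (qL (edge B)) (qR (edge B)) (qLt (edge B)) (qD (edge B) m) \<tau> i p"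
proof (induction p arbitrary: i)
  case (PBr p q)
  have "i < path_bound" "2 * i < path_bound" "Suc (2 * i) < path_bound"
    using PBr.prems(2) by (auto dest: bounded_less)
  moreover have "size (at t j) \<le> B" for j using size_at[of t j] B by linarith
  moreover from this[of i] have "size (inst \<sigma> p) \<le> B" "size (inst \<sigma> q) \<le> B" "size (Br (inst \<sigma> p) (inst \<sigma> q)) \<le> B"
    using PBr.prems(1) by auto
  ultimately show ?case
    using PBr by (auto simp: \<tau> quad_edge quad_mark)
next
  case (PDer p)
  then have "i < path_bound" "1 < path_bound" by (auto dest: bounded_less simp: path_bound_def)
  moreover have "size (at t j) \<le> B" for j using size_at[of t j] B by linarith
  ultimately show ?case
    using PDer B by (auto simp: \<tau> quad_edge quad_mark m)
qed (use \<tau> in auto)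

text \<open>Inverts \<open>var_of\<close>: quotient and remainder by 4 recover the element and the
  copy.\<close>

definition asg :: "(nat \<Rightarrow> tree) \<Rightarrow> nat \<Rightarrow> nat" where
  "asg \<tau> n = (if n < 5 then to_nat (Marker n)
     else to_nat (Copy (\<tau> ((n - 5) div 4)) ((n - 5) mod 4)))"

lemma asg_var_of [simp]: "c < 4 \<Longrightarrow> asg \<tau> (var_of i c) = to_nat (Copy (\<tau> i) c)"
  by (simp add: asg_def var_of_def)

lemma tup_asg: "(\<And>c. c < 4 \<Longrightarrow> a (var_of i c) = asg \<tau> (var_of i c)) \<Longrightarrow> tup a i = copies (\<tau> i)"
  by (simp add: tup_def copies_def)

lemma asg_in: "(n \<ge> 5 \<Longrightarrow> size (\<tau> ((n - 5) div 4)) \<le> B) \<Longrightarrow> asg \<tau> n \<in> to_nat ` vertices B"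
  unfolding asg_def by (auto intro!: imageI)

text \<open>The model consists of all trees up to a size bound, with genuine subtree relations,
  order by size and validity as \<open>D\<close>.\<close>

lemma phi_complete:
  assumes "ev tDiag (num e) Tip"
  shows "fin_graph_satisfiable (phi e)"
proof -
  obtain pf where dv: "valid (Br (Br tDiag (Br (num e) Tip)) pf)"
    using ev_valid[OF assms] by blast
  define d where "d = Br (Br tDiag (Br (num e) Tip)) pf"
  \<comment> \<open>Large enough for the derivation with all its subtrees and for the numerals up to
    \<open>e + 11\<close>.\<close>
  define B where "B = max (size d) (e + 11)"
  let ?V = "to_nat ` vertices B" and ?E = "edge B"
  define \<tau> where "\<tau> i = (if i = goal_ix 0 then d else if i = goal_ix 1 then Br tDiag (Br (num e) Tip)
    else if i = goal_ix 2 then Br (num e) Tip else if i = goal_ix 3 then pf else num (i - num_ix 0))" for i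
  have \<tau>_simps [simp]: "\<tau> (goal_ix 0) = d" "\<tau> (goal_ix 1) = Br tDiag (Br (num e) Tip)"
    "\<tau> (goal_ix (Suc 0)) = Br tDiag (Br (num e) Tip)" "\<tau> (goal_ix 2) = Br (num e) Tip" "\<tau> (goal_ix 3) = pf" "\<tau> (num_ix k) = num k" for k
    by (auto simp: \<tau>_def goal_ix_def num_ix_def)
  have size_\<tau>: "size (\<tau> i) \<le> B" if "i \<le> num_ix (e + 11)" for i
    using that by (auto simp: \<tau>_def B_def d_def num_ix_def)
  have "sat ?V ?E a (phi e)" if a: "\<forall>x. a x \<in> ?V" for a
  proof -
    let ?s = "var_of (goal_ix 0) 0" and ?n = "4 * (e + 16)"
    define b1 where "b1 n = (if ?s \<le> n \<and> n < ?s + ?n then asg \<tau> n else a n)" for n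
    define b2 where "b2 n = (if n < 5 then asg \<tau> n else b1 n)" for n
    have "varies ?V ?s ?n a b1"
      unfolding varies_def b1_def
      by (auto simp: var_of_def num_ix_def goal_ix_def intro!: asg_in size_\<tau>)
    moreover have "varies ?V 0 5 b1 b2"
      unfolding varies_def b2_def by (auto intro!: asg_in)
    moreover have "\<exists>b4. varies ?V 17 (8 * path_bound) b3 b4 \<and> sat ?V ?E b4 (body e)" if b3: "varies ?V 5 12 b2 b3" for b3
    proof -
      have m3: "b3 k = to_nat (Marker k)" if "k < 5" for k
        using b3 that by (auto simp: varies_def b2_def asg_def)
      have const: "tup b3 i = copies (\<tau> i)" if "goal_ix 0 \<le> i" "i \<le> num_ix (e + 11)" for i
      proof (rule tup_asg)
        fix c :: nat assume "c < 4"
        with that have "\<not> var_of i c < 17" "?s \<le> var_of i c" "var_of i c < ?s + ?n"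
          by (auto simp: var_of_def goal_ix_def num_ix_def)
        then show "b3 (var_of i c) = asg \<tau> (var_of i c)"
          using b3[unfolded varies_def, rule_format, of "var_of i c"] by (auto simp: b2_def b1_def)
      qed
      \<comment> \<open>The witnesses depend only on the first universal quadruple. They matter when
        it codes a valid derivation and are all \<open>Tip\<close> otherwise.\<close>
      have "\<exists>w. (\<forall>i. size (w i) \<le> B) \<and> (\<forall>t. tup b3 0 = copies t \<and> size t \<le> B \<and> valid t \<longrightarrow> w (path_ix 1) = t \<and>
          (\<forall>\<upsilon>. (\<forall>i. 3 \<le> i \<and> i < 3 + 2 * path_bound \<longrightarrow> \<upsilon> i = copies (w i)) \<and> (\<forall>k\<le>11. \<upsilon> (num_ix k) = copies (num k)) \<longrightarrow>
            (\<exists>p\<in>set rules. fits (qL ?E) (qR ?E) (qLt ?E) (qD ?E b3) \<upsilon> 1 p)))"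
      proof (cases "\<exists>t. tup b3 0 = copies t \<and> size t \<le> B \<and> valid t")
        case True
        then obtain t where t: "tup b3 0 = copies t" "size t \<le> B" "valid t" by blast
        from \<open>valid t\<close> obtain p \<sigma> where p: "p \<in> set rules" "t = inst \<sigma> p"
          "\<forall>q\<in>marked p. valid (inst \<sigma> q)"
          by (auto elim: valid.cases)
        have bd: "bounded path_bound 1 p" using rules_bounded[OF p(1)] by (simp add: path_bound_def)
        \<comment> \<open>Odd indices are addresses and even ones pattern variables. Values of
          variables occurring in the rule are at most as large as \<open>t\<close>; an oversized
          value of any other variable is replaced by \<open>Tip\<close>.\<close>
        define w where "w i = (if odd i then at t ((i - 3) div 2)
          else if size (\<sigma> ((i - 4) div 2)) \<le> B then \<sigma> ((i - 4) div 2) else Tip)" for i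
        have size_w: "size (w i) \<le> B" for i
          using size_at[of t "(i - 3) div 2"] t(2) by (auto simp: w_def)
        have w_tp: "w (path_ix i) = at t i" for i by (simp add: w_def path_ix_def)
        have w_tv: "w (pvar_ix v) = \<sigma> v" if "v \<in> pvars p" for v
          using size_pvars[OF that, of \<sigma>] t(2) p(2) by (simp add: w_def pvar_ix_def)
        show ?thesis
        proof (intro exI[of _ w] conjI allI impI)
          fix t' assume t': "tup b3 0 = copies t' \<and> size t' \<le> B \<and> valid t'"
          then show "w (path_ix 1) = t'" using t(1) w_tp[of 1] by simp
          fix \<upsilon> assume \<upsilon>: "(\<forall>i. 3 \<le> i \<and> i < 3 + 2 * path_bound \<longrightarrow> \<upsilon> i = copies (w i)) \<and>
            (\<forall>k\<le>11. \<upsilon> (num_ix k) = copies (num k))"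
          have "\<upsilon> (path_ix i) = copies (at t i)" if "i < path_bound" for i
            using \<upsilon>[THEN conjunct1, rule_format, of "path_ix i"] that w_tp by (simp add: path_ix_def)
          moreover have "\<upsilon> (pvar_ix v) = copies (\<sigma> v)" if "v \<in> pvars p" for v
            using \<upsilon>[THEN conjunct1, rule_format, of "pvar_ix v"] w_tv[OF that] pvars_bounded[OF bd that]
            by (simp add: pvar_ix_def)
          ultimately have "fits (qL ?E) (qR ?E) (qLt ?E) (qD ?E b3) \<upsilon> 1 p"
            using \<upsilon> t(2) p rules_size_marked[OF p(1)] bd
            by (intro fits_at[where t = t and \<sigma> = \<sigma>] m3) auto
          with p(1) show "\<exists>p\<in>set rules. fits (qL ?E) (qR ?E) (qLt ?E) (qD ?E b3) \<upsilon> 1 p" by blast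
        qed (rule size_w)
      next
        case False
        then show ?thesis by (intro exI[of _ "\<lambda>_. Tip"]) auto
      qed
      then obtain w where w: "\<forall>i. size (w i) \<le> B"
        "\<And>t \<upsilon>. tup b3 0 = copies t \<Longrightarrow> size t \<le> B \<Longrightarrow> valid t \<Longrightarrow> w (path_ix 1) = t"
        "\<And>t \<upsilon>. tup b3 0 = copies t \<Longrightarrow> size t \<le> B \<Longrightarrow> valid t \<Longrightarrow>
          \<forall>i. 3 \<le> i \<and> i < 3 + 2 * path_bound \<longrightarrow> \<upsilon> i = copies (w i) \<Longrightarrow> \<forall>k\<le>11. \<upsilon> (num_ix k) = copies (num k) \<Longrightarrow>
          \<exists>p\<in>set rules. fits (qL ?E) (qR ?E) (qLt ?E) (qD ?E b3) \<upsilon> 1 p"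
        by blast
      define b4 where "b4 n = (if 17 \<le> n \<and> n < 17 + 8 * path_bound then asg w n else b3 n)" for n
      have 1: "varies ?V 17 (8 * path_bound) b3 b4"
        unfolding varies_def b4_def using w(1) by (auto intro!: asg_in)
      have m4: "b4 k = to_nat (Marker k)" if "k < 5" for k
        using that m3 by (simp add: b4_def)
      have cong: "qNode ?E b4 = qNode ?E b3" "qD ?E b4 = qD ?E b3"
        by (auto intro!: ext qNode_cong qD_cong simp: b4_def)
      have low: "tup b4 i = tup b3 i" if "i < 3" for i
        using that by (intro tup_eqI) (auto simp: b4_def var_of_def)
      have mid: "tup b4 i = copies (w i)" if "3 \<le> i" "i < 3 + 2 * path_bound" for i
        using that by (intro tup_asg) (auto simp: b4_def var_of_def)
      have high: "tup b4 i = copies (\<tau> i)" if "goal_ix 0 \<le> i" "i \<le> num_ix (e + 11)" for i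
      proof -
        have "tup b4 i = tup b3 i"
          using that by (intro tup_eqI) (auto simp: b4_def var_of_def goal_ix_def)
        then show ?thesis using const[OF that] by simp
      qed
      have chain: "tup b4 (num_ix k) = copies (num k)" if "k \<le> e + 11" for k
      proof -
        have "goal_ix 0 \<le> num_ix k" "num_ix k \<le> num_ix (e + 11)" using that by (auto simp: goal_ix_def num_ix_def)
        then show ?thesis using high[of "num_ix k"] by simp
      qed
      have goal: "tup b4 (goal_ix i) = copies (\<tau> (goal_ix i))" if "i < 4" for i
        using high[of "goal_ix i"] that by (simp add: goal_ix_def num_ix_def)
      have small: "size (num k) \<le> B" if "k \<le> e + 11" for k
        using that by (simp add: B_def)
      have gsmall: "size (\<tau> (goal_ix i)) \<le> B" if "i < 4" for i
        using size_\<tau>[of "goal_ix i"] that by (simp add: goal_ix_def num_ix_def)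
      have "sat ?V ?E b4 (body e)"
        unfolding sat_body
      proof (intro conjI[of "_ \<longrightarrow> _"] impI)
        assume "qNode ?E b4 (tup b4 0) \<and> qNode ?E b4 (tup b4 1) \<and> qNode ?E b4 (tup b4 2)"
        then have nodes: "qNode ?E b4 (tup b4 0)" "qNode ?E b4 (tup b4 1)" "qNode ?E b4 (tup b4 2)"
          by simp_all
        obtain x y z where xyz: "tup b4 0 = copies x" "tup b4 1 = copies y" "tup b4 2 = copies z"
          and sizes: "size x \<le> B" "size y \<le> B" "size z \<le> B"
          using qNode_edge[OF m4 nodes(1)] qNode_edge[OF m4 nodes(2)] qNode_edge[OF m4 nodes(3)]
          by metis
        have "(\<forall>i\<in>{3..<3 + 2 * path_bound}. qNode ?E b4 (tup b4 i)) \<and> tup b4 (path_ix 1) = copies x \<and>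
          (\<exists>p\<in>set rules. fits (qL ?E) (qR ?E) (qLt ?E) (qD ?E b4) (tup b4) 1 p)" if "valid x"
        proof (intro conjI ballI)
          have x: "tup b3 0 = copies x" using xyz(1) low[of 0] by simp
          show "tup b4 (path_ix 1) = copies x"
            using w(2)[OF x sizes(1) that] mid[of "path_ix 1"] by (simp add: path_ix_def path_bound_def)
          show "\<exists>p\<in>set rules. fits (qL ?E) (qR ?E) (qLt ?E) (qD ?E b4) (tup b4) 1 p"
            unfolding cong using mid chain by (intro w(3)[OF x sizes(1) that]) auto
          fix i assume "i \<in> {3..<3 + 2 * path_bound}"
          then show "qNode ?E b4 (tup b4 i)"
            using w(1) by (simp add: mid quad_edge quad_mark m4)
        qed
        with xyz sizes chain[of 0] show "\<not> qLt ?E (tup b4 0) (tup b4 0) \<and>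
          (qLt ?E (tup b4 0) (tup b4 1) \<and> qLt ?E (tup b4 1) (tup b4 2) \<longrightarrow> qLt ?E (tup b4 0) (tup b4 2)) \<and>
          (qL ?E (tup b4 0) (tup b4 1) \<longrightarrow> qLt ?E (tup b4 1) (tup b4 0)) \<and>
          (qR ?E (tup b4 0) (tup b4 1) \<longrightarrow> qLt ?E (tup b4 1) (tup b4 0)) \<and>
          (qL ?E (tup b4 0) (tup b4 1) \<and> qL ?E (tup b4 0) (tup b4 2) \<longrightarrow> tup b4 1 = tup b4 2) \<and>
          (qR ?E (tup b4 0) (tup b4 1) \<and> qR ?E (tup b4 0) (tup b4 2) \<longrightarrow> tup b4 1 = tup b4 2) \<and>
          \<not> qL ?E (tup b4 (num_ix 0)) (tup b4 0) \<and>
          (qD ?E b4 (tup b4 0) \<longrightarrow> (\<forall>i\<in>{3..<3 + 2 * path_bound}. qNode ?E b4 (tup b4 i)) \<and>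
            tup b4 (path_ix 1) = tup b4 0 \<and> (\<exists>p\<in>set rules. fits (qL ?E) (qR ?E) (qLt ?E) (qD ?E b4) (tup b4) 1 p))"
          by (auto simp: quad_edge quad_mark m4)
      next
        show "(qNode ?E b4 (tup b4 (goal_ix 0)) \<and> qNode ?E b4 (tup b4 (goal_ix 1)) \<and> qNode ?E b4 (tup b4 (goal_ix 2)) \<and>
            qNode ?E b4 (tup b4 (goal_ix 3))) \<and> qD ?E b4 (tup b4 (goal_ix 0)) \<and>
          qL ?E (tup b4 (goal_ix 0)) (tup b4 (goal_ix 1)) \<and> qR ?E (tup b4 (goal_ix 0)) (tup b4 (goal_ix 3)) \<and>
          qL ?E (tup b4 (goal_ix 1)) (tup b4 (num_ix 7)) \<and> qR ?E (tup b4 (goal_ix 1)) (tup b4 (goal_ix 2)) \<and>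
          qR ?E (tup b4 (goal_ix 2)) (tup b4 (num_ix 0)) \<and> qL ?E (tup b4 (goal_ix 2)) (tup b4 (num_ix e)) \<and>
          (\<forall>k\<le>e + 11. qNode ?E b4 (tup b4 (num_ix k))) \<and>
          (\<forall>k<e + 11. qL ?E (tup b4 (num_ix (Suc k))) (tup b4 (num_ix 0)) \<and> qR ?E (tup b4 (num_ix (Suc k))) (tup b4 (num_ix k)))"
          using gsmall[of 0] gsmall[of 1] gsmall[of 2] gsmall[of 3] dv small
          by (simp add: goal chain quad_edge quad_mark m4 d_def[symmetric]) (auto simp: d_def)
      qed
      with 1 show ?thesis by blast
    qed
    ultimately show ?thesis
      unfolding phi_def sat_exs sat_alls by blast
  qed
  then show ?thesis
    using finite_graph_edge unfolding fin_graph_satisfiable_def true_in_def by blast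
qed

section \<open>Recursiveness of the coding and diagonalization\<close>

text \<open>Agreement is asked only on lists of the right length, so that functions may be rewritten
  freely under this assumption.\<close>

definition rec_fun :: "nat \<Rightarrow> (nat list \<Rightarrow> nat) \<Rightarrow> bool" where
  "rec_fun k f \<longleftrightarrow> (\<exists>g. recursive k g \<and> (\<forall>xs. length xs = k \<longrightarrow> g xs = f xs))"

lemma rec_funI: "recursive k g \<Longrightarrow> (\<And>xs. length xs = k \<Longrightarrow> f xs = g xs) \<Longrightarrow> rec_fun k f"
  by (auto simp: rec_fun_def)

lemma rec_fun_cong: "rec_fun k f \<Longrightarrow> (\<And>xs. length xs = k \<Longrightarrow> f xs = g xs) \<Longrightarrow> rec_fun k g"
  by (auto simp: rec_fun_def)

lemma rec_fun_comp:
  assumes "rec_fun (length hs) g" "\<forall>h\<in>set hs. rec_fun k h"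
  shows "rec_fun k (\<lambda>xs. g (map (\<lambda>h. h xs) hs))"
proof -
  obtain G where G: "recursive (length hs) G" "\<And>xs. length xs = length hs \<Longrightarrow> G xs = g xs"
    using assms(1) by (auto simp: rec_fun_def)
  obtain F where F: "\<And>h. h \<in> set hs \<Longrightarrow> recursive k (F h) \<and> (\<forall>xs. length xs = k \<longrightarrow> F h xs = h xs)"
    using assms(2) unfolding rec_fun_def by metis
  have "recursive k (\<lambda>xs. G (map (\<lambda>h. h xs) (map F hs)))"
    using G(1) F by (intro recursive.comp) auto
  moreover have "G (map (\<lambda>h. h xs) (map F hs)) = g (map (\<lambda>h. h xs) hs)" if "length xs = k" for xs
  proof -
    have "map (\<lambda>h. h xs) (map F hs) = map (\<lambda>h. h xs) hs" using F that by auto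
    then show ?thesis
      using G(2)[of "map (\<lambda>h. h xs) (map F hs)"] by (simp only: length_map)
  qed
  ultimately show ?thesis unfolding rec_fun_def by blast
qed

lemma rec_fun_comp1: "recursive 1 g \<Longrightarrow> rec_fun k h \<Longrightarrow> rec_fun k (\<lambda>xs. g [h xs])"
  using rec_fun_comp[of "[h]" g k] by (auto intro: rec_funI)

lemma rec_fun_nth: "i < k \<Longrightarrow> rec_fun k (\<lambda>xs. xs ! i)"
  by (rule rec_funI[OF recursive.proj]) auto

lemma rec_fun_Suc: "rec_fun k h \<Longrightarrow> rec_fun k (\<lambda>xs. Suc (h xs))"
  using rec_fun_comp1[OF recursive.succ] by simp

lemma rec_fun_const: "rec_fun k (\<lambda>_. c)"
  by (induction c) (auto intro: rec_funI recursive.zero rec_fun_Suc)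

lemma rec_fun_rec_nat:
  assumes f: "rec_fun k f" and F: "rec_fun (Suc (Suc k)) (\<lambda>ys. F (ys ! 0) (ys ! 1))" and h: "rec_fun k h"
  shows "rec_fun k (\<lambda>xs. rec_nat (f xs) F (h xs))"
proof -
  obtain f' where f': "recursive k f'" "\<And>xs. length xs = k \<Longrightarrow> f' xs = f xs"
    using f by (auto simp: rec_fun_def)
  obtain g where g: "recursive (Suc (Suc k)) g" "\<And>ys. length ys = Suc (Suc k) \<Longrightarrow> g ys = F (ys ! 0) (ys ! 1)"
    using F by (auto simp: rec_fun_def)
  \<comment> \<open>\<open>primrec_op\<close> expects the recursion argument in front of the
    parameters.\<close>
  let ?hs = "h # map (\<lambda>i xs. xs ! i) [0..<k]"
  have "rec_fun k (\<lambda>xs. primrec_op f' g (map (\<lambda>h. h xs) ?hs))"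
    using recursive.prim[OF f'(1) g(1)] h by (intro rec_fun_comp) (auto intro: rec_funI rec_fun_nth)
  then show ?thesis
  proof (rule rec_fun_cong)
    fix xs :: "nat list" assume xs: "length xs = k"
    then have "map (\<lambda>h. h xs) ?hs = h xs # xs" by (auto intro: nth_equalityI)
    moreover have "rec_nat (f' xs) (\<lambda>z r. g (z # r # xs)) n = rec_nat (f xs) F n" for n
      using f'(2) g(2) xs by (induction n) auto
    ultimately show "primrec_op f' g (map (\<lambda>h. h xs) ?hs) = rec_nat (f xs) F (h xs)"
      by (simp add: primrec_op_def)
  qed
qed

lemma rec_fun_add: 
  assumes "rec_fun k f" "rec_fun k g"
  shows "rec_fun k (\<lambda>xs. f xs + g xs)"
proof -
  have "rec_fun k (\<lambda>xs. rec_nat (f xs) (\<lambda>_ r. Suc r) (g xs))"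
    using assms by (intro rec_fun_rec_nat rec_fun_Suc rec_fun_nth) auto
  moreover have "rec_nat a (\<lambda>_ r. Suc r) b = a + b" for a b :: nat
    by (induction b) auto
  ultimately show ?thesis by simp
qed

lemma rec_fun_mult_const: "rec_fun k f \<Longrightarrow> rec_fun k (\<lambda>xs. c * f xs)"
  by (induction c) (auto intro: rec_fun_const rec_fun_add)

lemma rec_fun_prod_encode:
  assumes "rec_fun k f" "rec_fun k g"
  shows "rec_fun k (\<lambda>xs. prod_encode (f xs, g xs))"
proof -
  have "rec_fun k (\<lambda>xs. rec_nat 0 (\<lambda>z r. r + Suc z) (f xs + g xs))"
    using assms by (intro rec_fun_rec_nat rec_fun_const rec_fun_add rec_fun_Suc rec_fun_nth) auto
  moreover have "rec_nat 0 (\<lambda>z r. r + Suc z) n = triangle n" for n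
    by (induction n) auto
  ultimately show ?thesis
    using assms by (auto simp: prod_encode_def intro: rec_fun_add)
qed

lemmas rec_fun_intros = rec_fun_const rec_fun_Suc rec_fun_add rec_fun_mult_const rec_fun_prod_encode

text \<open>The length of the constant block grows with \<open>e\<close>, so its code must be
  computed by primitive recursion on that length.\<close>

lemma code_exs: "code (exs s n p) = rec_nat (code p) (\<lambda>i r. prod_encode (6, prod_encode (s + i, r))) n"
  by (induction n) auto

lemma code_alls: "code (alls s n p) = rec_nat (code p) (\<lambda>i r. prod_encode (7, prod_encode (s + i, r))) n"
  by (induction n) auto

lemma code_chain: "code (chain n) = rec_nat (code (fNode (num_ix 0)))
    (\<lambda>n r. prod_encode (3, prod_encode
      (code (conj [fNode (num_ix (Suc n)), fL (num_ix (Suc n)) (num_ix 0), fR (num_ix (Suc n)) (num_ix n)]), r))) n"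
  by (induction n) auto

text \<open>The input enters through the length of the outer block, the length of the chain and one
  atom; all other parts have fixed codes.\<close>

lemma rec_fun_phi: "rec_fun 1 (\<lambda>xs. code (phi (xs ! 0)))"
proof -
  have "rec_fun 1 (\<lambda>xs. code (chain (xs ! 0 + 11)))"
    unfolding code_chain
    by (intro rec_fun_rec_nat)
       (auto simp: conj_def fNode_def fL_def fR_def var_of_def num_ix_def intro!: rec_fun_intros rec_fun_nth)
  then have "rec_fun 1 (\<lambda>xs. code (body (xs ! 0)))"
    unfolding body_def
    by (auto simp: fL_def var_of_def num_ix_def intro!: rec_fun_intros rec_fun_nth)
  then show ?thesis
    unfolding phi_def code_exs code_alls
    by (intro rec_fun_rec_nat rec_fun_intros rec_fun_nth) auto
qed

section \<open>The diagonal argument\<close>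

lemma inj_code: "inj code"
proof (rule injI)
  show "code p = code q \<Longrightarrow> p = q" for p q
  proof (induction p arbitrary: q)
    case (Eq i j) then show ?case by (cases q) auto
  next
    case (Rel i j) then show ?case by (cases q) auto
  next
    case (Neg p) then show ?case by (cases q) auto
  next
    case (Conj p1 p2) then show ?case by (cases q) auto
  next
    case (Disj p1 p2) then show ?case by (cases q) auto
  next
    case (Imp p1 p2) then show ?case by (cases q) auto
  next
    case (Ex x p) then show ?case by (cases q) auto
  next
    case (All x p) then show ?case by (cases q) auto
  qed
qed

lemma phi_SAT_class: "phi e \<in> SAT_class 12 (8 * path_bound) 0 \<longleftrightarrow> ev tDiag (num e) Tip"
  using phi_class[of e] phi_sound[of _ _ e] phi_complete[of e]
  unfolding SAT_class_def fin_graph_satisfiable_def by blast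

theorem theorem5p10:
  shows "\<exists>l m n :: nat. \<not> decidable (code ` SAT_class l m n)"
proof (intro exI notI)
  assume "decidable (code ` SAT_class 12 (8 * path_bound) 0)"
  then obtain f where f: "recursive 1 f" "\<And>x. f [x] = 0 \<longleftrightarrow> x \<in> code ` SAT_class 12 (8 * path_bound) 0"
    by (auto simp: decidable_def)
  \<comment> \<open>Swaps the answer: \<open>?F\<close> vanishes exactly where the supposed decision
    function \<open>f\<close> does not.\<close>
  let ?F = "\<lambda>xs. rec_nat 1 (\<lambda>_ _. 0) (f [code (phi (xs ! 0))])"
  have "rec_fun 1 ?F"
    by (intro rec_fun_rec_nat rec_fun_const rec_fun_comp1[OF f(1)] rec_fun_phi)
  then obtain g where g: "recursive 1 g" "\<And>xs. length xs = 1 \<Longrightarrow> g xs = ?F xs"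
    by (auto simp: rec_fun_def)
  obtain t where t: "computes 1 t g" using recursive_computes[OF g(1)] ..
  obtain e where e: "\<And>y. ev tDecode (num e) y \<longleftrightarrow> y = t" using decode_surj by blast
  \<comment> \<open>Since \<open>e\<close> decodes to the program of \<open>g\<close>, the diagonal
    run on \<open>e\<close> is the run of \<open>g\<close> on its own number.\<close>
  have "ev tDiag (num e) Tip \<longleftrightarrow> ev t (lst [e]) (num 0)"
    by (simp add: ev_decode_iff e)
  also have "\<dots> \<longleftrightarrow> g [e] = 0"
    using t unfolding computes_def by (metis length_Cons list.size(3) num_inject One_nat_def)
  also have "\<dots> \<longleftrightarrow> f [code (phi e)] \<noteq> 0"
    using g(2)[of "[e]"] by (cases "f [code (phi e)]") auto
  also have "\<dots> \<longleftrightarrow> \<not> ev tDiag (num e) Tip"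
    using f(2) phi_SAT_class inj_code by (simp add: inj_image_mem_iff)
  finally show False by blast
qed

end
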